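(* Let $H$ be an abelian group with a decoupled action on a (finite-dimensional, pure) simplicial complex $\Sigma$. If $\Sigma$ is homotopy Cohen--Macaulay, then so is the poset $\overline{P_\Sigma/H}$.
   Context: A simplicial complex $\Sigma$ on a (possibly infinite) vertex set $V$ is a family of finite subsets of $V$ closed under taking subsets and containing all singletons; $\dim\sigma=|\sigma|-1$; $\Sigma$ is pure if all maximal faces have the same dimension. $P_\Sigma$ is the poset of all faces of $\Sigma$ (including $\emptyset$) ordered by inclusion. An action of $H$ on $\Sigma$ is an action by permutations of $V$ preserving $\Sigma$ (equivalently an action on $P_\Sigma$ by automorphisms); $\operatorname{stab}_H(\sigma)=\{h\in H\mid h\sigma=\sigma\}$. $P_\Sigma/H$ is the set of orbits ordered by $Hp\leq Hq$ iff $hp\leq q$ for some $h\in H$, and $\overline{P_\Sigma/H}$ is this poset with its minimal element (the orbit of $\emptyset$) removed. An action on a poset $P$ is translative if for all $p\in P$ and all group elements $h$, whenever $\{p,hp\}$ has an upper bound in $P$ then $hp=p$. An action of $H$ on $\Sigma$ is translative if the action on $P_\Sigma$ is. An action of $H$ on a pure $d$-dimensional simplicial complex $\Sigma$ is decoupled if it is translative and there is a (fixed, internal) direct sum decomposition $H=\bigoplus_{i=0}^d H_i$ with $H_i\neq\{0\}$ for all $i$, such that every maximal simplex $\sigma$ can be written as $\sigma=\{x_0,\dots,x_d\}$ with $H_i=\operatorname{stab}_H(\sigma\setminus\{x_i\})$ for all $i=0,\dots,d$. If $\dim\Sigma=0$ it is further required that $\operatorname{stab}_H(\sigma)=\{0\}$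 for all $\sigma\in\Sigma\setminus\{\emptyset\}$. A simplicial complex is $t$-connected ($t\geq 0$) if it is nonempty, connected and its homotopy groups $\pi_i$ are trivial for $1\leq i\leq t$; $(-1)$-connected means nonempty; for $t\le -2$ the condition is void. The link of $\sigma\in\Sigma$ is $\operatorname{lk}(\sigma)=\{\tau\in\Sigma\mid\tau\cap\sigma=\emptyset,\ \tau\cup\sigma\in\Sigma\}$. A finite-dimensional simplicial complex $\Sigma$ is homotopy Cohen--Macaulay if for every face $\sigma\in\Sigma$ (including $\sigma=\emptyset$), $\operatorname{lk}(\sigma)$ is $(\dim\operatorname{lk}(\sigma)-1)$-connected. A poset is homotopy Cohen--Macaulay if its order complex (the simplicial complex of its finite chains) is. *)

theory Defs
  imports
    "HOL-Analysis.Analysis"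
    "HOL-Algebra.FiniteProduct"
    "HOL-Algebra.Group_Action"
    "HOL-Algebra.Product_Groups"
begin

section \<open>Simplicial complexes\<close>

definition abstract_simplicial_complex :: "'v set \<Rightarrow> 'v set set \<Rightarrow> bool" where
  "abstract_simplicial_complex V \<Sigma> \<longleftrightarrow>
     {} \<in> \<Sigma> \<and>
     (\<forall>\<sigma>\<in>\<Sigma>. finite \<sigma> \<and> \<sigma> \<subseteq> V) \<and>
     (\<forall>\<sigma>\<in>\<Sigma>. \<forall>\<tau>. \<tau> \<subseteq> \<sigma> \<longrightarrow> \<tau> \<in> \<Sigma>) \<and>
     (\<forall>v\<in>V. {v} \<in> \<Sigma>)"

definition face_dim :: "'v set \<Rightarrow> int" where
  "face_dim \<sigma> = int (card \<sigma>) - 1"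

definition finite_dimensional :: "'v set set \<Rightarrow> bool" where
  "finite_dimensional \<Sigma> \<longleftrightarrow> (\<exists>n. \<forall>\<sigma>\<in>\<Sigma>. face_dim \<sigma> \<le> n)"

text \<open>Meaningful only for finite-dimensional complexes; the complex \<open>{{}}\<close> has dimension -1.\<close>

definition complex_dim :: "'v set set \<Rightarrow> int" where
  "complex_dim \<Sigma> = Max (face_dim ` \<Sigma>)"

definition maximal_faces :: "'v set set \<Rightarrow> 'v set set" where
  "maximal_faces \<Sigma> = {\<sigma>\<in>\<Sigma>. \<forall>\<tau>\<in>\<Sigma>. \<sigma> \<subseteq> \<tau> \<longrightarrow> \<tau> = \<sigma>}"

definition pure_complex :: "'v set set \<Rightarrow> bool" where
  "pure_complex \<Sigma> \<longleftrightarrow> (\<forall>\<sigma>\<in>maximal_faces \<Sigma>. \<forall>\<tau>\<in>maximal_faces \<Sigma>. face_dim \<sigma> = face_dim \<tau>)"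

definition link :: "'v set set \<Rightarrow> 'v set \<Rightarrow> 'v set set" where
  "link \<Sigma> \<sigma> = {\<tau>\<in>\<Sigma>. \<tau> \<inter> \<sigma> = {} \<and> \<tau> \<union> \<sigma> \<in> \<Sigma>}"

section \<open>Geometric realization\<close>

text \<open>Points of the realization are given by barycentric coordinates. A complex may have
  infinitely many vertices, so the realization carries the weak topology with respect to its closed
  simplices (not the subspace topology of the product topology). The empty face
  contributes no points.\<close>

definition closed_simplex :: "'v set \<Rightarrow> ('v \<Rightarrow> real) set" where
  "closed_simplex \<sigma> = {x. (\<forall>v. 0 \<le> x v) \<and> (\<forall>v. v \<notin> \<sigma> \<longrightarrow> x v = 0) \<and> (\<Sum>v\<in>\<sigma>. x v) = 1}"

definition realization_open :: "'v set set \<Rightarrow> ('v \<Rightarrow> real) set \<Rightarrow> bool" where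
  "realization_open \<Sigma> U \<longleftrightarrow>
     U \<subseteq> (\<Union>\<sigma>\<in>\<Sigma>. closed_simplex \<sigma>) \<and>
     (\<forall>\<sigma>\<in>\<Sigma>. openin (subtopology (powertop_real UNIV) (closed_simplex \<sigma>)) (U \<inter> closed_simplex \<sigma>))"

definition realization :: "'v set set \<Rightarrow> ('v \<Rightarrow> real) topology" where
  "realization \<Sigma> = topology (realization_open \<Sigma>)"

lemma istopology_realization_open: "istopology (realization_open \<Sigma>)"
proof -
  have "realization_open \<Sigma> (S \<inter> T)" if "realization_open \<Sigma> S" "realization_open \<Sigma> T" for S T
  proof -
    have "S \<inter> T \<inter> C = (S \<inter> C) \<inter> (T \<inter> C)" for C
      by blast
    then show ?thesis
      using that unfolding realization_open_def by (auto intro: openin_Int)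
  qed
  moreover have "realization_open \<Sigma> (\<Union>\<K>)" if "\<forall>K\<in>\<K>. realization_open \<Sigma> K" for \<K>
  proof -
    have "openin (subtopology (powertop_real UNIV) (closed_simplex \<sigma>)) (\<Union>\<K> \<inter> closed_simplex \<sigma>)"
      if "\<sigma> \<in> \<Sigma>" for \<sigma>
    proof -
      have "openin (subtopology (powertop_real UNIV) (closed_simplex \<sigma>)) (\<Union>((\<lambda>K. K \<inter> closed_simplex \<sigma>) ` \<K>))"
        using that \<open>\<forall>K\<in>\<K>. realization_open \<Sigma> K\<close>
        unfolding realization_open_def by (intro openin_Union) blast
      moreover have "\<Union>\<K> \<inter> closed_simplex \<sigma> = \<Union>((\<lambda>K. K \<inter> closed_simplex \<sigma>) ` \<K>)"
        by blast
      ultimately show ?thesis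
        by (rule ssubst[rotated])
    qed
    moreover have "\<Union>\<K> \<subseteq> (\<Union>\<sigma>\<in>\<Sigma>. closed_simplex \<sigma>)"
      using that unfolding realization_open_def by blast
    ultimately show ?thesis
      unfolding realization_open_def by blast
  qed
  ultimately show ?thesis
    by (simp add: istopology_def)
qed

lemma openin_realization: "openin (realization \<Sigma>) = realization_open \<Sigma>"
  by (simp add: realization_def istopology_realization_open topology_inverse')

lemma topspace_realization: "topspace (realization \<Sigma>) = (\<Union>\<sigma>\<in>\<Sigma>. closed_simplex \<sigma>)"
proof
  show "topspace (realization \<Sigma>) \<subseteq> (\<Union>\<sigma>\<in>\<Sigma>. closed_simplex \<sigma>)"
    by (auto simp: topspace_def openin_realization realization_open_def)
  have "openin (subtopology (powertop_real UNIV) (closed_simplex \<tau>))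
          ((\<Union>\<sigma>\<in>\<Sigma>. closed_simplex \<sigma>) \<inter> closed_simplex \<tau>)" if "\<tau> \<in> \<Sigma>" for \<tau>
  proof -
    have "(\<Union>\<sigma>\<in>\<Sigma>. closed_simplex \<sigma>) \<inter> closed_simplex \<tau>
        = topspace (subtopology (powertop_real UNIV) (closed_simplex \<tau>))"
      using that by auto
    then show ?thesis
      by (simp only: openin_topspace)
  qed
  then have "realization_open \<Sigma> (\<Union>\<sigma>\<in>\<Sigma>. closed_simplex \<sigma>)"
    unfolding realization_open_def by blast
  then show "(\<Union>\<sigma>\<in>\<Sigma>. closed_simplex \<sigma>) \<subseteq> topspace (realization \<Sigma>)"
    by (intro openin_subset) (simp add: openin_realization)
qed

section \<open>Connectivity\<close>

definition sphere_basepoint :: "nat \<Rightarrow> real" where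
  "sphere_basepoint = (\<lambda>k. if k = 0 then 1 else 0)"

definition based_sphere_maps :: "nat \<Rightarrow> 'a topology \<Rightarrow> 'a \<Rightarrow> ((nat \<Rightarrow> real) \<Rightarrow> 'a) set" where
  "based_sphere_maps n X x = {f. continuous_map (nsphere n) X f \<and> f sphere_basepoint = x}"

text \<open>The underlying set of the \<open>n\<close>-th homotopy group of \<open>(X, x)\<close>. The group structure is not
  needed to say that the group is trivial.\<close>

definition homotopy_group_set ::
    "nat \<Rightarrow> 'a topology \<Rightarrow> 'a \<Rightarrow> ((nat \<Rightarrow> real) \<Rightarrow> 'a) set set" where
  "homotopy_group_set n X x =
     based_sphere_maps n X x //
       {(f, g). f \<in> based_sphere_maps n X x \<and> g \<in> based_sphere_maps n X x \<and>
                homotopic_with (\<lambda>h. h sphere_basepoint = x) (nsphere n) X f g}"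

definition t_connected_space :: "int \<Rightarrow> 'a topology \<Rightarrow> bool" where
  "t_connected_space t X \<longleftrightarrow>
     (t \<ge> -1 \<longrightarrow> topspace X \<noteq> {}) \<and>
     (t \<ge> 0 \<longrightarrow> connected_space X) \<and>
     (\<forall>n\<ge>1. int n \<le> t \<longrightarrow> (\<forall>x\<in>topspace X. is_singleton (homotopy_group_set n X x)))"

definition t_connected :: "int \<Rightarrow> 'v set set \<Rightarrow> bool" where
  "t_connected t \<Sigma> \<longleftrightarrow> t_connected_space t (realization \<Sigma>)"

definition homotopy_Cohen_Macaulay :: "'v set set \<Rightarrow> bool" where
  "homotopy_Cohen_Macaulay \<Sigma> \<longleftrightarrow>
     finite_dimensional \<Sigma> \<and>
     (\<forall>\<sigma>\<in>\<Sigma>. t_connected (complex_dim (link \<Sigma> \<sigma>) - 1) (link \<Sigma> \<sigma>))"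

definition order_complex :: "'p set \<Rightarrow> ('p \<Rightarrow> 'p \<Rightarrow> bool) \<Rightarrow> 'p set set" where
  "order_complex P leq = {C. C \<subseteq> P \<and> finite C \<and> Complete_Partial_Order.chain leq C}"

definition poset_homotopy_Cohen_Macaulay :: "'p set \<Rightarrow> ('p \<Rightarrow> 'p \<Rightarrow> bool) \<Rightarrow> bool" where
  "poset_homotopy_Cohen_Macaulay P leq \<longleftrightarrow> homotopy_Cohen_Macaulay (order_complex P leq)"

section \<open>Group actions on complexes\<close>

definition complex_action ::
    "('g, 'm) monoid_scheme \<Rightarrow> 'v set \<Rightarrow> 'v set set \<Rightarrow> ('g \<Rightarrow> 'v \<Rightarrow> 'v) \<Rightarrow> bool" where
  "complex_action H V \<Sigma> \<phi> \<longleftrightarrow>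
     group_action H V \<phi> \<and> (\<forall>h\<in>carrier H. \<forall>\<sigma>\<in>\<Sigma>. \<phi> h ` \<sigma> \<in> \<Sigma>)"

definition face_action :: "'v set set \<Rightarrow> ('g \<Rightarrow> 'v \<Rightarrow> 'v) \<Rightarrow> 'g \<Rightarrow> 'v set \<Rightarrow> 'v set" where
  "face_action \<Sigma> \<phi> h = (\<lambda>\<sigma>\<in>\<Sigma>. \<phi> h ` \<sigma>)"

definition translative_on ::
    "('g, 'm) monoid_scheme \<Rightarrow> 'p set \<Rightarrow> ('p \<Rightarrow> 'p \<Rightarrow> bool) \<Rightarrow> ('g \<Rightarrow> 'p \<Rightarrow> 'p) \<Rightarrow> bool" where
  "translative_on H P leq \<psi> \<longleftrightarrow>
     (\<forall>p\<in>P. \<forall>h\<in>carrier H. (\<exists>q\<in>P. leq p q \<and> leq (\<psi> h p) q) \<longrightarrow> \<psi> h p = p)"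

definition translative ::
    "('g, 'm) monoid_scheme \<Rightarrow> 'v set set \<Rightarrow> ('g \<Rightarrow> 'v \<Rightarrow> 'v) \<Rightarrow> bool" where
  "translative H \<Sigma> \<phi> \<longleftrightarrow> translative_on H \<Sigma> (\<subseteq>) (face_action \<Sigma> \<phi>)"

text \<open>The canonical map from the external direct sum is an isomorphism. Used only for finite
  index sets, where \<open>finprod\<close> has its intended meaning.\<close>

definition internal_direct_sum ::
    "('g, 'm) monoid_scheme \<Rightarrow> 'i set \<Rightarrow> ('i \<Rightarrow> 'g set) \<Rightarrow> bool" where
  "internal_direct_sum H I Hs \<longleftrightarrow>
     (\<forall>i\<in>I. subgroup (Hs i) H) \<and>
     (\<lambda>c. finprod H c I) \<in> iso (sum_group I (\<lambda>i. H\<lparr>carrier := Hs i\<rparr>)) H"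

text \<open>To be used for pure, finite-dimensional complexes. The \<open>x i\<close> are then automatically distinct,
  since a maximal simplex has \<open>complex_dim \<Sigma> + 1\<close> elements.\<close>

definition decoupled ::
    "('g, 'm) monoid_scheme \<Rightarrow> 'v set set \<Rightarrow> ('g \<Rightarrow> 'v \<Rightarrow> 'v) \<Rightarrow> bool" where
  "decoupled H \<Sigma> \<phi> \<longleftrightarrow>
     translative H \<Sigma> \<phi> \<and>
     (\<exists>Hs :: int \<Rightarrow> 'g set.
        internal_direct_sum H {0..complex_dim \<Sigma>} Hs \<and>
        (\<forall>i\<in>{0..complex_dim \<Sigma>}. Hs i \<noteq> {\<one>\<^bsub>H\<^esub>}) \<and>
        (\<forall>\<sigma>\<in>maximal_faces \<Sigma>. \<exists>x :: int \<Rightarrow> 'v.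
           \<sigma> = x ` {0..complex_dim \<Sigma>} \<and>
           (\<forall>i\<in>{0..complex_dim \<Sigma>}. Hs i = stabilizer H (face_action \<Sigma> \<phi>) (\<sigma> - {x i})))) \<and>
     (complex_dim \<Sigma> = 0 \<longrightarrow>
        (\<forall>\<sigma>\<in>\<Sigma> - {{}}. stabilizer H (face_action \<Sigma> \<phi>) \<sigma> = {\<one>\<^bsub>H\<^esub>}))"

definition orbit_le ::
    "('g, 'm) monoid_scheme \<Rightarrow> 'p set \<Rightarrow> ('p \<Rightarrow> 'p \<Rightarrow> bool) \<Rightarrow> ('g \<Rightarrow> 'p \<Rightarrow> 'p) \<Rightarrow>
     'p set \<Rightarrow> 'p set \<Rightarrow> bool" where
  "orbit_le H P leq \<psi> A B \<longleftrightarrow>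
     (\<exists>p\<in>P. \<exists>q\<in>P. A = orbit H \<psi> p \<and> B = orbit H \<psi> q \<and> (\<exists>h\<in>carrier H. leq (\<psi> h p) q))"

definition reduced_face_orbits ::
    "('g, 'm) monoid_scheme \<Rightarrow> 'v set set \<Rightarrow> ('g \<Rightarrow> 'v \<Rightarrow> 'v) \<Rightarrow> 'v set set set" where
  "reduced_face_orbits H \<Sigma> \<phi> =
     orbits H \<Sigma> (face_action \<Sigma> \<phi>) - {orbit H (face_action \<Sigma> \<phi>) {}}"

definition face_orbit_le ::
    "('g, 'm) monoid_scheme \<Rightarrow> 'v set set \<Rightarrow> ('g \<Rightarrow> 'v \<Rightarrow> 'v) \<Rightarrow>
     'v set set \<Rightarrow> 'v set set \<Rightarrow> bool" where
  "face_orbit_le H \<Sigma> \<phi> = orbit_le H \<Sigma> (\<subseteq>) (face_action \<Sigma> \<phi>)"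

end

theory Submission
  imports Defs
begin

text \<open>
  Translativity and the stabilizer conditions colour the vertices of \<open>\<Sigma>\<close> so that each summand \<open>H\<^sub>i\<close>
  moves the vertices of colour \<open>i\<close> only. Hence the vertices of a face can be moved independently
  within their orbits, and the orbit poset is the face poset of the subcomplex \<open>D\<close> spanned by a
  choice of orbit representatives.

  For a chain \<open>C\<close> of nonempty faces in \<open>D\<close>, choose one vertex in each difference of consecutive
  members of \<open>C\<close>, and let \<open>S\<close> be the set of chosen vertices. The link of \<open>C\<close> in the order complex is
  a join of boundaries of simplices, one for each difference, with the subdivided link of \<open>\<Union>C\<close>.
  The boundary of a simplex on the vertices \<open>B\<close> is homeomorphic to the boundary of the cross-polytope on \<open>B\<close> minus
  the chosen vertex, and \<open>\<Sigma>\<close> contains this cross-polytope, because every vertex of a face with at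
  least two vertices has a second vertex in its orbit. This embeds the link of \<open>C\<close> into the
  link of \<open>S\<close> in \<open>\<Sigma>\<close>, and there is a retraction in the opposite direction. So the
  connectivity of the latter link passes to the former.
\<close>

section \<open>Retracts and maps of realizations\<close>

text \<open>A difference \<open>B\<close> with chosen vertex \<open>a\<close> yields a
  cross-polytope for this reason: a non-constant function on \<open>B\<close> modulo constants
  determines the chain of its proper upper level sets with positive coefficients, so such functions
  up to positive scaling are the points of the boundary of the simplex on \<open>B\<close>.
  Subtracting the value at \<open>a\<close> makes them nonzero vectors indexed by
  \<open>B - {a}\<close>, which up to scaling form the boundary of the cross-polytope. The
  retraction reverses this: it turns a point of the link of \<open>S\<close> into a function on the
  vertices and reads off the gaps between its levels. The obstacle is that this link may contain
  further vertices of an orbit, and faces whose representatives do not span a face together with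
  \<open>\<Union>C\<close>. So the function is given by a formula that makes sense on the whole
  link, and at every point some level set must be shown to be a vertex of the link of
  \<open>C\<close>. The degree of connectivity is right because \<open>S\<close> has at most as many
  vertices as \<open>C\<close> has members, so that the link of \<open>S\<close> has at least the
  dimension of the link of \<open>C\<close>.\<close>

lemma is_singleton_homotopy_group_set_iff:
  assumes "x \<in> topspace X"
  shows "is_singleton (homotopy_group_set n X x) \<longleftrightarrow>
    (\<forall>f\<in>based_sphere_maps n X x. \<forall>g\<in>based_sphere_maps n X x.
       homotopic_with (\<lambda>h. h sphere_basepoint = x) (nsphere n) X f g)"
proof -
  let ?B = "based_sphere_maps n X x"
  define R where "R = {(f, g). f \<in> ?B \<and> g \<in> ?B \<and>
    homotopic_with (\<lambda>h. h sphere_basepoint = x) (nsphere n) X f g}"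
  have refl: "(f, f) \<in> R" if "f \<in> ?B" for f
    using that by (simp add: R_def based_sphere_maps_def)
  have const: "(\<lambda>_. x) \<in> ?B"
    using assms by (simp add: based_sphere_maps_def)
  have "is_singleton (?B // R) \<longleftrightarrow> (\<forall>f\<in>?B. \<forall>g\<in>?B. (f, g) \<in> R)"
  proof
    assume "is_singleton (?B // R)"
    then obtain c where c: "?B // R = {c}"
      by (auto simp: is_singleton_def)
    have "R `` {f} = c" if "f \<in> ?B" for f
      using c quotientI[OF that, of R] by simp
    then show "\<forall>f\<in>?B. \<forall>g\<in>?B. (f, g) \<in> R"
      using refl by blast
  next
    assume all: "\<forall>f\<in>?B. \<forall>g\<in>?B. (f, g) \<in> R"
    then have "R `` {f} = ?B" if "f \<in> ?B" for f
      using that by (auto simp: R_def)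
    then have "?B // R = {?B}"
      using const unfolding quotient_def by blast
    then show "is_singleton (?B // R)"
      by simp
  qed
  then show ?thesis
    unfolding homotopy_group_set_def R_def[symmetric] by (auto simp: R_def)
qed

text \<open>Two based maps into \<open>X\<close> become homotopic in \<open>Y\<close> after applying
  \<open>i\<close>; applying \<open>r\<close> to that homotopy brings it back.\<close>

lemma t_connected_space_retract:
  assumes Y: "t_connected_space t Y"
    and i: "continuous_map X Y i" and r: "continuous_map Y X r"
    and ri: "\<And>x. x \<in> topspace X \<Longrightarrow> r (i x) = x"
  shows "t_connected_space t X"
  unfolding t_connected_space_def
proof (intro conjI impI allI ballI)
  assume "t \<ge> -1"
  then show "topspace X \<noteq> {}"
    using Y continuous_map_image_subset_topspace[OF r] by (auto simp: t_connected_space_def)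
next
  assume "t \<ge> 0"
  then have "connectedin Y (topspace Y)"
    using Y by (simp add: t_connected_space_def connectedin_topspace)
  moreover have "r ` topspace Y = topspace X"
  proof
    show "r ` topspace Y \<subseteq> topspace X"
      using continuous_map_image_subset_topspace[OF r] .
    show "topspace X \<subseteq> r ` topspace Y"
      using ri continuous_map_image_subset_topspace[OF i] by force
  qed
  ultimately show "connected_space X"
    using connectedin_continuous_map_image[OF r, of "topspace Y"] by (simp add: connectedin_topspace)
next
  fix n :: nat and x assume n: "1 \<le> n" "int n \<le> t" and x: "x \<in> topspace X"
  have ix: "i x \<in> topspace Y"
    using x continuous_map_image_subset_topspace[OF i] by auto
  have "homotopic_with (\<lambda>h. h sphere_basepoint = x) (nsphere n) X f g"
    if f: "f \<in> based_sphere_maps n X x" and g: "g \<in> based_sphere_maps n X x" for f g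
  proof -
    have cf: "continuous_map (nsphere n) X f" and cg: "continuous_map (nsphere n) X g"
      using f g by (auto simp: based_sphere_maps_def)
    have "i \<circ> f \<in> based_sphere_maps n Y (i x)" "i \<circ> g \<in> based_sphere_maps n Y (i x)"
      using f g i by (auto simp: based_sphere_maps_def intro: continuous_map_compose)
    moreover have "is_singleton (homotopy_group_set n Y (i x))"
      using Y n ix by (simp add: t_connected_space_def)
    ultimately have "homotopic_with (\<lambda>h. h sphere_basepoint = i x) (nsphere n) Y (i \<circ> f) (i \<circ> g)"
      using is_singleton_homotopy_group_set_iff[OF ix] by blast
    then have "homotopic_with (\<lambda>h. h sphere_basepoint = x) (nsphere n) X (r \<circ> (i \<circ> f)) (r \<circ> (i \<circ> g))"
      by (rule homotopic_with_compose_continuous_map_left[OF _ r]) (simp add: ri[OF x])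
    \<comment> \<open>\<open>r \<circ> i\<close> is the identity only on the points of
      \<open>X\<close>, so the composites agree with \<open>f\<close> and \<open>g\<close> on the
      sphere but need not equal them as functions.\<close>
    moreover have "homotopic_with (\<lambda>h. h sphere_basepoint = x) (nsphere n) X (r \<circ> (i \<circ> f)) f"
      "homotopic_with (\<lambda>h. h sphere_basepoint = x) (nsphere n) X (r \<circ> (i \<circ> g)) g"
      using continuous_map_image_subset_topspace[OF cf] continuous_map_image_subset_topspace[OF cg]
        f g ri x i r cf cg
      by (auto intro!: homotopic_with_equal continuous_map_compose simp: based_sphere_maps_def)
    ultimately show ?thesis
      by (meson homotopic_with_symD homotopic_with_trans)
  qed
  then show "is_singleton (homotopy_group_set n X x)"
    using is_singleton_homotopy_group_set_iff[OF x] by blast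
qed

lemma t_connected_space_mono: "t_connected_space t X \<Longrightarrow> s \<le> t \<Longrightarrow> t_connected_space s X"
  by (auto simp: t_connected_space_def)

lemma closed_closed_simplex: "closed (closed_simplex \<sigma>)"
proof -
  have eval: "continuous_on UNIV (\<lambda>x::'a \<Rightarrow> real. x v)" for v
    by (rule continuous_on_product_coordinates)
  have "closed_simplex \<sigma> =
     (\<Inter>v. {x. 0 \<le> x v}) \<inter> ((\<Inter>v\<in>-\<sigma>. {x. x v = 0}) \<inter> {x. (\<Sum>v\<in>\<sigma>. x v) = 1})"
    unfolding closed_simplex_def by blast
  moreover have "closed (\<Inter>v. {x::'a\<Rightarrow>real. 0 \<le> x v})"
    by (intro closed_INT ballI closed_Collect_le continuous_on_const eval)
  moreover have "closed (\<Inter>v\<in>-\<sigma>. {x::'a\<Rightarrow>real. x v = 0})"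
    by (intro closed_INT ballI closed_Collect_eq continuous_on_const eval)
  moreover have "closed {x::'a\<Rightarrow>real. (\<Sum>v\<in>\<sigma>. x v) = 1}"
    by (intro closed_Collect_eq continuous_on_sum continuous_on_const eval)
  ultimately show ?thesis
    by (metis closed_Int)
qed

text \<open>On a finite union of closed simplices the weak topology is that of the product, so
  coordinatewise continuity is enough once the image of each simplex lies in such a union. Over an
  infinite \<open>F\<close> the closed sets \<open>closed_simplex \<tau> - U\<close> could have a
  union that is not closed.\<close>

lemma continuous_map_realizationI:
  assumes carrier: "\<And>\<sigma>. \<sigma> \<in> K \<Longrightarrow>
      \<exists>F. finite F \<and> F \<subseteq> L \<and> f ` closed_simplex \<sigma> \<subseteq> (\<Union>\<tau>\<in>F. closed_simplex \<tau>)"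
    and cont: "\<And>\<sigma> v. \<sigma> \<in> K \<Longrightarrow> continuous_on (closed_simplex \<sigma>) (\<lambda>x. f x v)"
  shows "continuous_map (realization K) (realization L) f"
  unfolding continuous_map_def topspace_realization
proof (intro conjI allI impI)
  show "f \<in> (\<Union>\<sigma>\<in>K. closed_simplex \<sigma>) \<rightarrow> (\<Union>\<tau>\<in>L. closed_simplex \<tau>)"
  proof
    fix x assume "x \<in> (\<Union>\<sigma>\<in>K. closed_simplex \<sigma>)"
    then obtain \<sigma> where \<sigma>: "\<sigma> \<in> K" "x \<in> closed_simplex \<sigma>"
      by (rule UN_E)
    obtain F where F: "F \<subseteq> L" "f ` closed_simplex \<sigma> \<subseteq> (\<Union>\<tau>\<in>F. closed_simplex \<tau>)"
      using carrier[OF \<sigma>(1)] by (elim exE conjE)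
    have "f x \<in> (\<Union>\<tau>\<in>F. closed_simplex \<tau>)"
      by (rule subsetD[OF F(2) imageI[OF \<sigma>(2)]])
    also have "\<dots> \<subseteq> (\<Union>\<tau>\<in>L. closed_simplex \<tau>)"
      by (rule UN_mono[OF F(1) subset_refl])
    finally show "f x \<in> (\<Union>\<tau>\<in>L. closed_simplex \<tau>)" .
  qed
  fix U assume "openin (realization L) U"
  then have U: "U \<subseteq> (\<Union>\<tau>\<in>L. closed_simplex \<tau>)"
    "\<And>\<tau>. \<tau> \<in> L \<Longrightarrow> openin (top_of_set (closed_simplex \<tau>)) (U \<inter> closed_simplex \<tau>)"
    by (auto simp: openin_realization realization_open_def euclidean_product_topology)
  let ?P = "{x \<in> \<Union>\<sigma>\<in>K. closed_simplex \<sigma>. f x \<in> U}"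
  have "openin (top_of_set (closed_simplex \<sigma>)) (?P \<inter> closed_simplex \<sigma>)" if \<sigma>: "\<sigma> \<in> K" for \<sigma>
  proof -
    obtain F where F: "finite F" "F \<subseteq> L" "f ` closed_simplex \<sigma> \<subseteq> (\<Union>\<tau>\<in>F. closed_simplex \<tau>)"
      using carrier[OF \<sigma>] by (elim exE conjE)
    have cf: "continuous_on (closed_simplex \<sigma>) f"
      using cont[OF \<sigma>] by (rule continuous_on_coordinatewise_then_product)
    have "closed (closed_simplex \<tau> - U)" if "\<tau> \<in> F" for \<tau>
    proof -
      have "closedin (top_of_set (closed_simplex \<tau>)) (closed_simplex \<tau> - (U \<inter> closed_simplex \<tau>))"
        using U(2)[of \<tau>] that F(2) by (intro closedin_diff) auto
      then have "closed (closed_simplex \<tau> - (U \<inter> closed_simplex \<tau>))"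
        using closed_closed_simplex closedin_closed_trans by blast
      moreover have "closed_simplex \<tau> - (U \<inter> closed_simplex \<tau>) = closed_simplex \<tau> - U"
        by blast
      ultimately show ?thesis
        by simp
    qed
    then have "closed (\<Union>\<tau>\<in>F. closed_simplex \<tau> - U)"
      using F(1) by (intro closed_UN) auto
    then have "closedin (top_of_set (closed_simplex \<sigma>))
        (closed_simplex \<sigma> \<inter> f -` (\<Union>\<tau>\<in>F. closed_simplex \<tau> - U))"
      using cf continuous_closedin_preimage by blast
    moreover have "closed_simplex \<sigma> \<inter> f -` (\<Union>\<tau>\<in>F. closed_simplex \<tau> - U)
        = closed_simplex \<sigma> - (?P \<inter> closed_simplex \<sigma>)"
      using F(3) \<sigma> by auto
    ultimately have "closedin (top_of_set (closed_simplex \<sigma>)) (closed_simplex \<sigma> - (?P \<inter> closed_simplex \<sigma>))"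
      by simp
    then show ?thesis
      by (simp add: openin_closedin_eq)
  qed
  then show "openin (realization K) ?P"
    by (auto simp: openin_realization realization_open_def euclidean_product_topology)
qed

section \<open>Isomorphic complexes\<close>

text \<open>\<open>i\<close> and \<open>r\<close> rename coordinates along \<open>g\<close> and its
  inverse; the value 0 at all other vertices makes \<open>r (i x) = x\<close> an equality of
  functions for points \<open>x\<close> of the realization.\<close>

lemma t_connected_image:
  assumes inj: "inj_on g (\<Union>K)"
    and K: "t_connected t K"
  shows "t_connected t ((`) g ` K)"
proof -
  let ?K' = "(`) g ` K"
  define i :: "('b \<Rightarrow> real) \<Rightarrow> 'a \<Rightarrow> real" where "i x v = (if v \<in> \<Union>K then x (g v) else 0)" for x v
  define r :: "('a \<Rightarrow> real) \<Rightarrow> 'b \<Rightarrow> real" where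
    "r y w = (if w \<in> g ` \<Union>K then y (inv_into (\<Union>K) g w) else 0)" for y w
  have eval: "continuous_on S (\<lambda>x::'c \<Rightarrow> real. x v)" for S :: "('c \<Rightarrow> real) set" and v
    by (rule continuous_on_subset[OF continuous_on_product_coordinates subset_UNIV])
  have ig: "inv_into (\<Union>K) g (g v) = v" if "v \<in> \<Union>K" for v
    using inj that by simp
  have i_in: "i x \<in> closed_simplex \<sigma>" if \<sigma>: "\<sigma> \<in> K" and x: "x \<in> closed_simplex (g ` \<sigma>)" for x \<sigma>
  proof -
    have "\<sigma> \<subseteq> \<Union>K"
      using \<sigma> by blast
    then have inj_\<sigma>: "inj_on g \<sigma>"
      using inj inj_on_subset by blast
    have "(\<Sum>v\<in>\<sigma>. i x v) = (\<Sum>v\<in>\<sigma>. x (g v))"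
      using \<open>\<sigma> \<subseteq> \<Union>K\<close> by (intro sum.cong) (auto simp: i_def)
    also have "\<dots> = (\<Sum>w\<in>g ` \<sigma>. x w)"
      using sum.reindex[OF inj_\<sigma>, of x] by simp
    finally have "(\<Sum>v\<in>\<sigma>. i x v) = 1"
      using x by (simp add: closed_simplex_def)
    moreover have "i x v = 0" if "v \<notin> \<sigma>" for v
    proof (cases "v \<in> \<Union>K")
      case True
      then have "g v \<notin> g ` \<sigma>"
        using inj_on_image_mem_iff[OF inj True \<open>\<sigma> \<subseteq> \<Union>K\<close>] that by simp
      then show ?thesis
        using x by (simp add: i_def closed_simplex_def)
    qed (simp add: i_def)
    ultimately show ?thesis
      using x by (simp add: closed_simplex_def i_def)
  qed
  have r_in: "r y \<in> closed_simplex (g ` \<sigma>)" if \<sigma>: "\<sigma> \<in> K" and y: "y \<in> closed_simplex \<sigma>" for y \<sigma>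
  proof -
    have "\<sigma> \<subseteq> \<Union>K"
      using \<sigma> by blast
    then have inj_\<sigma>: "inj_on g \<sigma>"
      using inj inj_on_subset by blast
    have "(\<Sum>w\<in>g ` \<sigma>. r y w) = (\<Sum>v\<in>\<sigma>. r y (g v))"
      using sum.reindex[OF inj_\<sigma>, of "r y"] by simp
    also have "\<dots> = (\<Sum>v\<in>\<sigma>. y v)"
    proof (rule sum.cong)
      fix v assume "v \<in> \<sigma>"
      then have "v \<in> \<Union>K"
        using \<open>\<sigma> \<subseteq> \<Union>K\<close> by blast
      then show "r y (g v) = y v"
        using ig by (simp add: r_def del: Union_iff)
    qed simp
    finally have "(\<Sum>w\<in>g ` \<sigma>. r y w) = 1"
      using y by (simp add: closed_simplex_def)
    moreover have "r y w = 0" if "w \<notin> g ` \<sigma>" for w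
    proof (cases "w \<in> g ` \<Union>K")
      case True
      then have "inv_into (\<Union>K) g w \<notin> \<sigma>"
        using that f_inv_into_f by (metis imageI)
      then show ?thesis
        using y by (simp add: r_def closed_simplex_def)
    qed (simp add: r_def)
    ultimately show ?thesis
      using y by (simp add: closed_simplex_def r_def)
  qed
  have ci: "continuous_map (realization ?K') (realization K) i"
  proof (rule continuous_map_realizationI)
    fix \<sigma>' assume "\<sigma>' \<in> ?K'"
    then obtain \<sigma> where \<sigma>: "\<sigma> \<in> K" "\<sigma>' = g ` \<sigma>"
      by (rule imageE)
    have "i ` closed_simplex \<sigma>' \<subseteq> (\<Union>\<tau>\<in>{\<sigma>}. closed_simplex \<tau>)"
      using i_in[OF \<sigma>(1)] \<sigma>(2) by (simp add: image_subset_iff)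
    then show "\<exists>F. finite F \<and> F \<subseteq> K \<and> i ` closed_simplex \<sigma>' \<subseteq> (\<Union>\<tau>\<in>F. closed_simplex \<tau>)"
      using \<sigma>(1) by (intro exI[of _ "{\<sigma>}"]) simp
    show "continuous_on (closed_simplex \<sigma>') (\<lambda>x. i x v)" for v
      by (cases "v \<in> \<Union>K") (simp_all add: i_def eval del: Union_iff)
  qed
  have cr: "continuous_map (realization K) (realization ?K') r"
  proof (rule continuous_map_realizationI)
    fix \<sigma> assume \<sigma>: "\<sigma> \<in> K"
    have "r ` closed_simplex \<sigma> \<subseteq> (\<Union>\<tau>\<in>{g ` \<sigma>}. closed_simplex \<tau>)"
      using r_in[OF \<sigma>] by (simp add: image_subset_iff)
    then show "\<exists>F. finite F \<and> F \<subseteq> ?K' \<and> r ` closed_simplex \<sigma> \<subseteq> (\<Union>\<tau>\<in>F. closed_simplex \<tau>)"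
      using \<sigma> by (intro exI[of _ "{g ` \<sigma>}"]) simp
    show "continuous_on (closed_simplex \<sigma>) (\<lambda>x. r x v)" for v
      by (cases "v \<in> g ` \<Union>K") (simp_all add: r_def eval del: Union_iff)
  qed
  have "r (i x) = x" if x_in: "x \<in> topspace (realization ?K')" for x
  proof -
    obtain \<sigma> where \<sigma>: "\<sigma> \<in> K" "x \<in> closed_simplex (g ` \<sigma>)"
      using x_in unfolding topspace_realization by (elim UN_E imageE) simp
    have "r (i x) w = x w" for w
    proof (cases "w \<in> g ` \<Union>K")
      case True
      then obtain v where v: "v \<in> \<Union>K" "w = g v"
        by (rule imageE)
      then show ?thesis
        using ig[OF v(1)] True by (simp add: r_def i_def del: Union_iff)
    next
      case False
      moreover have "w \<notin> g ` \<sigma>"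
        using False \<sigma>(1) by blast
      ultimately show ?thesis
        using \<sigma>(2) by (simp add: r_def closed_simplex_def)
    qed
    then show ?thesis ..
  qed
  then show ?thesis
    using t_connected_space_retract[OF _ ci cr] K unfolding t_connected_def by blast
qed

lemma link_image:
  assumes inj: "inj_on g (\<Union>K)" and \<sigma>: "\<sigma> \<in> K"
  shows "link ((`) g ` K) (g ` \<sigma>) = (`) g ` link K \<sigma>"
proof -
  have "(g ` \<tau> \<inter> g ` \<sigma> = {} \<and> g ` \<tau> \<union> g ` \<sigma> \<in> (`) g ` K) \<longleftrightarrow> (\<tau> \<inter> \<sigma> = {} \<and> \<tau> \<union> \<sigma> \<in> K)"
    if \<tau>: "\<tau> \<in> K" for \<tau>
  proof -
    have sub: "\<tau> \<subseteq> \<Union>K" "\<sigma> \<subseteq> \<Union>K"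
      using \<tau> \<sigma> by auto
    have "g ` \<tau> \<inter> g ` \<sigma> = g ` (\<tau> \<inter> \<sigma>)"
      using inj_on_image_Int[OF inj sub] by simp
    moreover have "g ` (\<tau> \<union> \<sigma>) \<in> (`) g ` K \<longleftrightarrow> \<tau> \<union> \<sigma> \<in> K"
    proof
      assume "g ` (\<tau> \<union> \<sigma>) \<in> (`) g ` K"
      then obtain \<rho> where \<rho>: "\<rho> \<in> K" "g ` (\<tau> \<union> \<sigma>) = g ` \<rho>"
        by blast
      then have "\<tau> \<union> \<sigma> = \<rho>"
        using inj_on_image_eq_iff[OF inj, of "\<tau> \<union> \<sigma>" \<rho>] sub by blast
      then show "\<tau> \<union> \<sigma> \<in> K"
        using \<rho>(1) by simp
    qed blast
    ultimately show ?thesis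
      by (auto simp: image_Un)
  qed
  note face_iff = this
  show ?thesis
  proof (intro equalityI subsetI)
    fix \<tau>' assume \<tau>': "\<tau>' \<in> link ((`) g ` K) (g ` \<sigma>)"
    then obtain \<tau> where \<tau>: "\<tau> \<in> K" "\<tau>' = g ` \<tau>"
      by (auto simp: link_def)
    then show "\<tau>' \<in> (`) g ` link K \<sigma>"
      using \<tau>' face_iff[OF \<tau>(1)] by (simp add: link_def)
  next
    fix \<tau>' assume "\<tau>' \<in> (`) g ` link K \<sigma>"
    then obtain \<tau> where \<tau>: "\<tau> \<in> link K \<sigma>" "\<tau>' = g ` \<tau>"
      by (rule imageE)
    then show "\<tau>' \<in> link ((`) g ` K) (g ` \<sigma>)"
      using face_iff[of \<tau>] by (simp add: link_def)
  qed
qed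

text \<open>Serves to replace the order complex of the orbit poset by that of the faces of
  representatives, whose vertices have a different type.\<close>

lemma homotopy_Cohen_Macaulay_image:
  assumes inj: "inj_on g (\<Union>K)"
    and K: "homotopy_Cohen_Macaulay K"
  shows "homotopy_Cohen_Macaulay ((`) g ` K)"
proof -
  have dim: "face_dim (g ` \<sigma>) = face_dim \<sigma>" if "\<sigma> \<in> K" for \<sigma>
  proof -
    have "inj_on g \<sigma>"
      using inj that by (meson Union_upper inj_on_subset)
    then show ?thesis
      by (simp add: face_dim_def card_image)
  qed
  have "t_connected (complex_dim (link ((`) g ` K) (g ` \<sigma>)) - 1) (link ((`) g ` K) (g ` \<sigma>))"
    if \<sigma>: "\<sigma> \<in> K" for \<sigma>
  proof -
    have sub: "link K \<sigma> \<subseteq> K"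
      by (auto simp: link_def)
    then have "face_dim ` (`) g ` link K \<sigma> = face_dim ` link K \<sigma>"
      using dim unfolding image_image by (intro image_cong) auto
    then have "complex_dim ((`) g ` link K \<sigma>) = complex_dim (link K \<sigma>)"
      by (simp add: complex_dim_def)
    moreover have "t_connected (complex_dim (link K \<sigma>) - 1) ((`) g ` link K \<sigma>)"
    proof (rule t_connected_image)
      show "inj_on g (\<Union>(link K \<sigma>))"
        using inj sub by (meson Union_mono inj_on_subset)
    qed (use K \<sigma> in \<open>auto simp: homotopy_Cohen_Macaulay_def\<close>)
    ultimately show ?thesis
      by (simp add: link_image[OF inj \<sigma>])
  qed
  moreover have "finite_dimensional ((`) g ` K)"
    using K dim by (auto simp: homotopy_Cohen_Macaulay_def finite_dimensional_def)
  ultimately show ?thesis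
    by (auto simp: homotopy_Cohen_Macaulay_def)
qed

section \<open>Coefficients of a function along its upper level sets\<close>

text \<open>If \<open>X\<close> is a nonnegative combination of the indicators of a chain of sets, then \<open>gap X\<close> recovers
  the coefficients.\<close>

definition gap :: "('v \<Rightarrow> real) \<Rightarrow> 'v set \<Rightarrow> real" where
  "gap X \<rho> = max 0 (Min (X ` \<rho>) - Max (insert 0 (X ` (- \<rho>))))"

lemma gap_nonneg: "0 \<le> gap X \<rho>"
  by (simp add: gap_def)

lemma finite_range_insert_Compl:
  assumes "finite (range X)"
  shows "finite (insert (0::real) (X ` (- \<rho>)))"
  using assms by (meson finite.insertI finite_subset image_mono subset_UNIV)

text \<open>Before truncation at 0, \<open>gap X \<rho>\<close> is the least of all
  \<open>X a\<close> and \<open>X a - X c\<close> with \<open>a\<close> in \<open>\<rho>\<close> and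
  \<open>c\<close> outside; \<open>ge\<close> makes \<open>g\<close> a lower bound and
  \<open>tight\<close> says that it is attained. The 0 inserted in \<open>gap_def\<close> acts as
  the value at a point outside every set of the chain.\<close>

lemma gap_eqI:
  assumes \<rho>: "finite \<rho>" and X: "finite (range X)" and g: "0 \<le> g"
    and ge: "\<And>a. a \<in> \<rho> \<Longrightarrow> g \<le> X a" "\<And>a c. a \<in> \<rho> \<Longrightarrow> c \<notin> \<rho> \<Longrightarrow> g \<le> X a - X c"
    and tight: "a \<in> \<rho>" "X a = g \<or> (\<exists>c. c \<notin> \<rho> \<and> X a - X c = g)"
  shows "gap X \<rho> = g"
proof -
  let ?N = "insert 0 (X ` (- \<rho>))"
  have N: "finite ?N"
    using X by (rule finite_range_insert_Compl)
  have "X ` \<rho> \<noteq> {}" "finite (X ` \<rho>)"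
    using \<rho> tight(1) by auto
  then have "Min (X ` \<rho>) \<in> X ` \<rho>"
    using Min_in by blast
  then obtain a0 where a0: "a0 \<in> \<rho>" "Min (X ` \<rho>) = X a0"
    by blast
  have "Max ?N \<in> ?N"
    using N by (intro Max_in) auto
  then have "g \<le> Min (X ` \<rho>) - Max ?N"
    using ge a0 by auto
  moreover have "Min (X ` \<rho>) \<le> X a"
    using \<rho> tight(1) by simp
  moreover have "0 \<le> Max ?N" "\<And>c. c \<notin> \<rho> \<Longrightarrow> X c \<le> Max ?N"
    using N by (auto intro: Max_ge)
  ultimately have "Min (X ` \<rho>) - Max ?N = g"
    using tight(2) by fastforce
  then show ?thesis
    using g by (simp add: gap_def)
qed

lemma gap_pos_iff:
  assumes \<rho>: "finite \<rho>" "\<rho> \<noteq> {}" and X: "finite (range X)"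
  shows "0 < gap X \<rho> \<longleftrightarrow> (\<forall>a\<in>\<rho>. 0 < X a) \<and> (\<forall>a\<in>\<rho>. \<forall>c. c \<notin> \<rho> \<longrightarrow> X c < X a)"
proof -
  let ?N = "insert 0 (X ` (- \<rho>))"
  have N: "finite ?N"
    using X by (rule finite_range_insert_Compl)
  have "0 < gap X \<rho> \<longleftrightarrow> Max ?N < Min (X ` \<rho>)"
    by (auto simp: gap_def)
  also have "\<dots> \<longleftrightarrow> (\<forall>n\<in>?N. \<forall>a\<in>\<rho>. n < X a)"
    using N \<rho> by (subst Max_less_iff) (auto simp: Min_gr_iff)
  finally show ?thesis
    by auto
qed

lemma continuous_on_Max_image:
  fixes f :: "'a \<Rightarrow> 'b::topological_space \<Rightarrow> real"
  assumes "finite A" "A \<noteq> {}" "\<And>a. a \<in> A \<Longrightarrow> continuous_on S (f a)"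
  shows "continuous_on S (\<lambda>x. Max ((\<lambda>a. f a x) ` A))"
  using assms
proof (induction A rule: finite_ne_induct)
  case (insert a A)
  then have "continuous_on S (\<lambda>x. max (f a x) (Max ((\<lambda>a. f a x) ` A)))"
    by (intro continuous_on_max) auto
  then show ?case
    using insert by simp
qed simp

lemma continuous_on_Min_image:
  fixes f :: "'a \<Rightarrow> 'b::topological_space \<Rightarrow> real"
  assumes "finite A" "A \<noteq> {}" "\<And>a. a \<in> A \<Longrightarrow> continuous_on S (f a)"
  shows "continuous_on S (\<lambda>x. Min ((\<lambda>a. f a x) ` A))"
  using assms
proof (induction A rule: finite_ne_induct)
  case (insert a A)
  then have "continuous_on S (\<lambda>x. min (f a x) (Min ((\<lambda>a. f a x) ` A)))"
    by (intro continuous_on_min) auto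
  then show ?case
    using insert by simp
qed simp

section \<open>Links of chains of orbit representatives\<close>

lemma finite_chain_Union_mem:
  assumes "finite E" "E \<noteq> {}" "Complete_Partial_Order.chain (\<subseteq>) E"
  shows "\<Union>E \<in> E"
  using assms
proof (induction E rule: finite_ne_induct)
  case (insert x F)
  then have "\<Union>F \<in> F" "x \<subseteq> \<Union>F \<or> \<Union>F \<subseteq> x"
    by (auto simp: chain_def)
  then show ?case
    by (auto simp: Un_absorb1 Un_absorb2)
qed simp

lemma finite_chain_Inter_mem:
  assumes "finite E" "E \<noteq> {}" "Complete_Partial_Order.chain (\<subseteq>) E"
  shows "\<Inter>E \<in> E"
  using assms
proof (induction E rule: finite_ne_induct)
  case (insert x F)
  then have IH: "\<Inter>F \<in> F"
    by (auto simp: chain_def)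
  then have "x \<subseteq> \<Inter>F \<or> \<Inter>F \<subseteq> x"
    using insert.prems by (auto simp: chain_def)
  then show ?case
    using IH by (auto simp: Int_absorb1 Int_absorb2)
qed simp

text \<open>Distinct members of a chain of finite sets have distinct cardinalities, here all between
  1 and that of the union.\<close>

lemma card_chain_le_card_Union:
  assumes E: "finite E" "Complete_Partial_Order.chain (\<subseteq>) E"
    and fin: "\<And>\<rho>. \<rho> \<in> E \<Longrightarrow> finite \<rho> \<and> \<rho> \<noteq> {}"
  shows "card E \<le> card (\<Union>E)"
proof -
  have "inj_on card E"
  proof (rule inj_onI)
    fix \<rho> \<rho>' assume \<rho>: "\<rho> \<in> E" "\<rho>' \<in> E" "card \<rho> = card \<rho>'"
    then have "\<rho> \<subseteq> \<rho>' \<or> \<rho>' \<subseteq> \<rho>"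
      using E(2) by (auto simp: chain_def)
    then show "\<rho> = \<rho>'"
      using \<rho> fin card_subset_eq by metis
  qed
  moreover have "card ` E \<subseteq> {1..card (\<Union>E)}"
  proof
    fix k assume "k \<in> card ` E"
    then obtain \<rho> where \<rho>: "\<rho> \<in> E" "k = card \<rho>"
      by blast
    have "finite (\<Union>E)"
      using E(1) fin by blast
    then have "card \<rho> \<le> card (\<Union>E)"
      using \<rho>(1) by (intro card_mono) auto
    moreover have "0 < card \<rho>"
      using fin[OF \<rho>(1)] by (simp add: card_gt_0_iff)
    ultimately show "k \<in> {1..card (\<Union>E)}"
      using \<rho>(2) by simp
  qed
  ultimately show ?thesis
    using card_inj_on_le[of card E "{1..card (\<Union>E)}"] by simp
qed

text \<open>The group is forgotten here: the fibres of \<open>rep\<close> stand for the orbits of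
  vertices, \<open>swap\<close> for the independent movement of the vertices of a face, and
  \<open>mate_exists\<close> for the nontriviality of the summands.\<close>

locale orbit_transversal =
  fixes \<Sigma> :: "'v set set" and rep :: "'v \<Rightarrow> 'v"
  assumes empty_face: "{} \<in> \<Sigma>"
    and finite_face: "\<sigma> \<in> \<Sigma> \<Longrightarrow> finite \<sigma>"
    and subset_face: "\<sigma> \<in> \<Sigma> \<Longrightarrow> \<tau> \<subseteq> \<sigma> \<Longrightarrow> \<tau> \<in> \<Sigma>"
    and rep_rep: "rep (rep v) = rep v"
    and rep_vertex: "v \<in> \<Union>\<Sigma> \<Longrightarrow> rep v \<in> \<Union>\<Sigma>"
    and inj_on_rep: "\<sigma> \<in> \<Sigma> \<Longrightarrow> inj_on rep \<sigma>"
    and swap: "\<sigma> \<in> \<Sigma> \<Longrightarrow> (\<And>v. v \<in> \<sigma> \<Longrightarrow> g v \<in> \<Union>\<Sigma> \<and> rep (g v) = rep v) \<Longrightarrow> g ` \<sigma> \<in> \<Sigma>"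
    and mate_exists: "\<sigma> \<in> \<Sigma> \<Longrightarrow> v \<in> \<sigma> \<Longrightarrow> w \<in> \<sigma> \<Longrightarrow> v \<noteq> w \<Longrightarrow>
      \<exists>v'\<in>\<Union>\<Sigma>. v' \<noteq> v \<and> rep v' = rep v"
begin

definition "D = {\<sigma> \<in> \<Sigma>. \<forall>v\<in>\<sigma>. rep v = v}"

lemma D_face: "\<rho> \<in> D \<Longrightarrow> \<rho> \<in> \<Sigma>"
  and D_rep: "\<rho> \<in> D \<Longrightarrow> b \<in> \<rho> \<Longrightarrow> rep b = b"
  and D_finite: "\<rho> \<in> D \<Longrightarrow> finite \<rho>"
  by (auto simp: D_def finite_face)

lemma D_subset: "\<rho> \<in> D \<Longrightarrow> \<tau> \<subseteq> \<rho> \<Longrightarrow> \<tau> \<in> D"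
  using subset_face by (auto simp: D_def)

lemma rep_image_D:
  assumes \<sigma>: "\<sigma> \<in> \<Sigma>"
  shows "rep ` \<sigma> \<in> D"
proof -
  have "rep ` \<sigma> \<in> \<Sigma>"
    by (rule swap[OF \<sigma>]) (use \<sigma> rep_vertex rep_rep in blast)
  then show ?thesis
    by (auto simp: D_def rep_rep)
qed

text \<open>The inverse of \<open>rep\<close> on \<open>M\<close> is an admissible \<open>g\<close>
  in \<open>swap\<close>, starting from the face of representatives.\<close>

lemma face_if_rep_image_face:
  assumes M: "inj_on rep M" "M \<subseteq> \<Union>\<Sigma>" and face: "rep ` M \<in> \<Sigma>"
  shows "M \<in> \<Sigma>"
proof -
  let ?g = "inv_into M rep"
  have "?g ` (rep ` M) \<in> \<Sigma>"
  proof (rule swap[OF face])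
    fix b assume "b \<in> rep ` M"
    then show "?g b \<in> \<Union>\<Sigma> \<and> rep (?g b) = rep b"
      using M inv_into_into[of b rep M] f_inv_into_f[of b rep M] rep_rep by auto
  qed
  then show ?thesis
    using M(1) by simp
qed

end

section \<open>Vertices and faces attached to a chain\<close>

locale transversal_chain = orbit_transversal +
  fixes C :: "'a set set"
  assumes C: "C \<in> order_complex (D - {{}}) (\<subseteq>)"
begin

definition "U = \<Union>C"

text \<open>Two vertices have the same \<open>lvl\<close> iff they lie in the same difference of consecutive members of
  \<open>C\<close>; then \<open>s\<close> is the chosen vertex of that difference.\<close>

definition "lvl b = {\<tau> \<in> C. b \<in> \<tau>}"

definition "s b = (SOME a. lvl a = lvl b)"

definition "S = s ` U"

text \<open>The antipode of \<open>b\<close> in the cross-polytope; a junk value unless \<open>b \<in> U\<close> and \<open>s b \<noteq> b\<close>.\<close>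

definition "p b = (SOME v. v \<in> \<Union>\<Sigma> \<and> v \<noteq> b \<and> rep v = b)"

definition "Q = {\<rho> \<in> D. \<rho> \<noteq> {} \<and> \<rho> \<notin> C \<and> (\<forall>\<tau>\<in>C. \<rho> \<subseteq> \<tau> \<or> \<tau> \<subseteq> \<rho>)}"

definition "L = link (order_complex (D - {{}}) (\<subseteq>)) C"

text \<open>The face at whose barycentre the embedding places the vertex \<open>\<rho>\<close>. On each difference it comes
  from subtracting from the indicator of \<open>\<rho>\<close> its value at the chosen vertex, where a negative
  coordinate at \<open>b\<close> is a positive one at \<open>p b\<close>.\<close>

definition "m \<rho> = (\<rho> - U) \<union> {b \<in> U \<inter> \<rho>. s b \<notin> \<rho>} \<union> p ` {b \<in> U - \<rho>. s b \<in> \<rho>}"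

lemma finite_C: "finite C"
  and C_D: "\<tau> \<in> C \<Longrightarrow> \<tau> \<in> D"
  and C_nonempty: "\<tau> \<in> C \<Longrightarrow> \<tau> \<noteq> {}"
  and C_chain: "Complete_Partial_Order.chain (\<subseteq>) C"
  using C by (auto simp: order_complex_def)

lemma C_total: "\<tau> \<in> C \<Longrightarrow> \<tau>' \<in> C \<Longrightarrow> \<tau> \<subseteq> \<tau>' \<or> \<tau>' \<subseteq> \<tau>"
  using C_chain by (auto simp: chain_def)

lemma Q_D: "\<rho> \<in> Q \<Longrightarrow> \<rho> \<in> D"
  and Q_nonempty: "\<rho> \<in> Q \<Longrightarrow> \<rho> \<noteq> {}"
  and Q_notin_C: "\<rho> \<in> Q \<Longrightarrow> \<rho> \<notin> C"
  and Q_total: "\<rho> \<in> Q \<Longrightarrow> \<tau> \<in> C \<Longrightarrow> \<rho> \<subseteq> \<tau> \<or> \<tau> \<subseteq> \<rho>"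
  by (auto simp: Q_def)

lemma in_L_iff: "E \<in> L \<longleftrightarrow> finite E \<and> E \<subseteq> Q \<and> Complete_Partial_Order.chain (\<subseteq>) E"
proof
  assume "E \<in> L"
  then have E: "finite E" "E \<subseteq> D - {{}}" "E \<inter> C = {}"
    and chain: "\<forall>x\<in>E \<union> C. \<forall>y\<in>E \<union> C. x \<subseteq> y \<or> y \<subseteq> x"
    unfolding L_def link_def order_complex_def chain_def by auto
  have "\<rho> \<in> Q" if "\<rho> \<in> E" for \<rho>
  proof -
    have "\<rho> \<in> D" "\<rho> \<noteq> {}" "\<rho> \<notin> C"
      using E(2,3) that by auto
    moreover have "\<rho> \<subseteq> \<tau> \<or> \<tau> \<subseteq> \<rho>" if "\<tau> \<in> C" for \<tau>
      using bspec[OF bspec[OF chain, of \<rho>], of \<tau>] \<open>\<rho> \<in> E\<close> that by simp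
    ultimately show ?thesis
      unfolding Q_def by simp
  qed
  then show "finite E \<and> E \<subseteq> Q \<and> Complete_Partial_Order.chain (\<subseteq>) E"
    using E(1) chain unfolding chain_def by (simp add: subset_iff)
next
  assume E: "finite E \<and> E \<subseteq> Q \<and> Complete_Partial_Order.chain (\<subseteq>) E"
  then have E_total: "\<rho> \<subseteq> \<rho>' \<or> \<rho>' \<subseteq> \<rho>" if "\<rho> \<in> E" "\<rho>' \<in> E" for \<rho> \<rho>'
    using that by (simp add: chain_def)
  have EQ: "\<rho> \<in> Q" if "\<rho> \<in> E" for \<rho>
    using E that by blast
  have "Complete_Partial_Order.chain (\<subseteq>) (E \<union> C)"
    unfolding chain_def
  proof (intro ballI)
    fix \<rho> \<rho>' assume "\<rho> \<in> E \<union> C" "\<rho>' \<in> E \<union> C"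
    then show "\<rho> \<subseteq> \<rho>' \<or> \<rho>' \<subseteq> \<rho>"
      using E_total[of \<rho> \<rho>'] C_total[of \<rho> \<rho>'] Q_total[OF EQ, of \<rho> \<rho>'] Q_total[OF EQ, of \<rho>' \<rho>]
      by (elim UnE) blast+
  qed
  then show "E \<in> L"
    using E C EQ[THEN Q_D] EQ[THEN Q_nonempty] EQ[THEN Q_notin_C]
    unfolding L_def link_def order_complex_def by auto
qed

lemma chain_L_Un_C: "E \<in> L \<Longrightarrow> Complete_Partial_Order.chain (\<subseteq>) (E \<union> C)"
  unfolding L_def link_def order_complex_def by auto

lemma Union_L_Un_C: "E \<in> L \<Longrightarrow> \<Union>(E \<union> C) \<in> D"
proof (cases "E \<union> C = {}")
  case True
  then show ?thesis
    by (simp add: D_def empty_face)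
next
  case False
  assume E: "E \<in> L"
  then have "\<Union>(E \<union> C) \<in> E \<union> C"
    using False finite_C chain_L_Un_C[OF E]
    by (intro finite_chain_Union_mem) (auto simp: in_L_iff)
  then show ?thesis
    using E C_D Q_D by (auto simp: in_L_iff)
qed

lemma empty_in_L: "{} \<in> L"
  by (simp add: in_L_iff chain_def)

lemma U_D: "U \<in> D"
  using Union_L_Un_C[OF empty_in_L] by (simp add: U_def)

lemma in_U_iff: "b \<in> U \<longleftrightarrow> lvl b \<noteq> {}"
  by (auto simp: U_def lvl_def)

text \<open>\<open>lvl b\<close> is an up-set of the chain \<open>C\<close>, and up-sets of a chain
  are nested. So its cardinality already identifies the level of \<open>b\<close>, which is what
  lets \<open>height\<close> use a number.\<close>

lemma lvl_total: "lvl a \<subseteq> lvl c \<or> lvl c \<subseteq> lvl a"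
  using C_total unfolding lvl_def by blast

lemma finite_lvl: "finite (lvl b)"
  using finite_C by (simp add: lvl_def)

lemma lvl_s: "lvl (s b) = lvl b"
  unfolding s_def by (rule someI) (rule refl)

lemma s_cong: "lvl a = lvl c \<Longrightarrow> s a = s c"
  by (simp add: s_def)

lemma s_s: "s (s b) = s b"
  by (rule s_cong[OF lvl_s])

lemma s_in_U_iff: "s b \<in> U \<longleftrightarrow> b \<in> U"
  by (simp add: in_U_iff lvl_s)

lemma in_S_iff: "b \<in> S \<longleftrightarrow> b \<in> U \<and> s b = b"
  unfolding S_def using s_s s_in_U_iff by force

lemma S_D: "S \<in> D"
  using U_D by (rule D_subset) (auto simp: in_S_iff)

text \<open>A nonempty \<open>lvl b\<close> consists of the members of \<open>C\<close> above its
  least one, so there are at most \<open>card C\<close> nonempty levels, and \<open>S\<close> has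
  one vertex in each.\<close>

lemma card_S: "card S \<le> card C"
proof -
  have "lvl ` U \<subseteq> (\<lambda>\<tau>. {\<tau>' \<in> C. \<tau> \<subseteq> \<tau>'}) ` C"
  proof
    fix l assume "l \<in> lvl ` U"
    then obtain b where b: "b \<in> U" "l = lvl b"
      by blast
    have "\<Inter>(lvl b) \<in> lvl b"
    proof (rule finite_chain_Inter_mem)
      show "Complete_Partial_Order.chain (\<subseteq>) (lvl b)"
        using C_chain by (auto simp: chain_def lvl_def)
    qed (use b finite_lvl in_U_iff in auto)
    then have "\<Inter>(lvl b) \<in> C" "lvl b = {\<tau>' \<in> C. \<Inter>(lvl b) \<subseteq> \<tau>'}"
      unfolding lvl_def by auto
    then show "l \<in> (\<lambda>\<tau>. {\<tau>' \<in> C. \<tau> \<subseteq> \<tau>'}) ` C"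
      using b(2) by blast
  qed
  then have "card (lvl ` U) \<le> card C"
    using finite_C by (meson card_image_le card_mono finite_imageI le_trans)
  moreover have "inj_on lvl S"
  proof (rule inj_onI)
    fix a c assume "a \<in> S" "c \<in> S" "lvl a = lvl c"
    then show "a = c"
      using s_cong[of a c] by (simp add: in_S_iff)
  qed
  moreover have "lvl ` S = lvl ` U"
    unfolding S_def image_image lvl_s ..
  ultimately show ?thesis
    by (metis card_image)
qed

text \<open>\<open>s b\<close> is the second vertex of the face \<open>U\<close> that
  \<open>mate_exists\<close> calls for.\<close>

lemma mate:
  assumes "b \<in> U" "s b \<noteq> b"
  shows "p b \<in> \<Union>\<Sigma>" "p b \<noteq> b" "rep (p b) = b"
proof -
  have "rep b = b"
    using assms U_D D_rep by blast
  have "\<exists>v. v \<in> \<Union>\<Sigma> \<and> v \<noteq> b \<and> rep v = b"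
    using mate_exists[OF D_face[OF U_D] assms(1), of "s b"] assms s_in_U_iff \<open>rep b = b\<close> by auto
  then have "p b \<in> \<Union>\<Sigma> \<and> p b \<noteq> b \<and> rep (p b) = b"
    unfolding p_def by (rule someI_ex)
  then show "p b \<in> \<Union>\<Sigma>" "p b \<noteq> b" "rep (p b) = b"
    by auto
qed

lemma in_m_fixed:
  assumes v: "rep v = v"
  shows "v \<in> m \<rho> \<longleftrightarrow> v \<in> \<rho> \<and> (v \<in> U \<longrightarrow> s v \<notin> \<rho>)"
proof -
  have "v \<noteq> p b" if "b \<in> U - \<rho>" "s b \<in> \<rho>" for b
  proof -
    have "s b \<noteq> b"
      using that by auto
    then show ?thesis
      using mate[of b] that v by auto
  qed
  then show ?thesis
    by (auto simp: m_def)
qed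

lemma mate_in_m:
  assumes b: "b \<in> U" "s b \<noteq> b" and \<rho>: "\<rho> \<in> D"
  shows "p b \<in> m \<rho> \<longleftrightarrow> b \<notin> \<rho> \<and> s b \<in> \<rho>"
proof -
  have "rep (p b) \<noteq> p b"
    using mate[OF b] by auto
  then have "p b \<notin> \<rho>" "p b \<notin> U"
    using D_rep[OF \<rho>] D_rep[OF U_D] by auto
  moreover have "b' = b" if "p b = p b'" "b' \<in> U - \<rho>" "s b' \<in> \<rho>" for b'
  proof -
    have "s b' \<noteq> b'"
      using that by auto
    then show ?thesis
      using mate(3)[OF b] mate(3)[of b'] that by auto
  qed
  ultimately show ?thesis
    using b by (auto simp: m_def)
qed

lemma m_cases:
  assumes "v \<in> m \<rho>" "\<rho> \<in> D"
  obtains "rep v = v" "v \<in> \<rho>" "v \<in> U \<Longrightarrow> s v \<notin> \<rho>"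
  | b where "b \<in> U" "s b \<noteq> b" "v = p b" "rep v = b" "b \<notin> \<rho>" "s b \<in> \<rho>"
  using assms mate(3) D_rep[OF assms(2)] unfolding m_def by auto metis+

lemma finite_m:
  assumes "\<rho> \<in> D" shows "finite (m \<rho>)"
  using D_finite[OF assms] D_finite[OF U_D] unfolding m_def by auto

text \<open>A \<open>\<rho>\<close> inside \<open>U\<close> lies strictly between two consecutive
  members of \<open>C\<close>, or below all of them, so it cuts the corresponding difference into
  two nonempty parts. One holds \<open>a\<close>, the other \<open>c\<close>; wherever the chosen
  vertex lies, \<open>a\<close> or \<open>p c\<close> is in \<open>m \<rho>\<close>.\<close>

lemma m_nonempty:
  assumes \<rho>: "\<rho> \<in> Q"
  shows "m \<rho> \<noteq> {}"
proof (cases "\<rho> \<subseteq> U")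
  case False
  then show ?thesis
    by (auto simp: m_def)
next
  case True
  let ?P = "{\<tau> \<in> C. \<tau> \<subset> \<rho>}" and ?N = "{\<tau> \<in> C. \<rho> \<subset> \<tau>}"
  have chains: "Complete_Partial_Order.chain (\<subseteq>) ?P" "Complete_Partial_Order.chain (\<subseteq>) ?N"
    using C_chain by (auto simp: chain_def)
  have PN: "\<tau> \<in> ?P \<or> \<tau> \<in> ?N" if "\<tau> \<in> C" for \<tau>
    using Q_total[OF \<rho> that] Q_notin_C[OF \<rho>] that by auto
  have "\<Union>?P \<subset> \<rho>"
  proof (cases "?P = {}")
    case True
    then show ?thesis
      using Q_nonempty[OF \<rho>] by (simp only: Union_empty) blast
  next
    case False
    then have "\<Union>?P \<in> ?P"
      using finite_C chains(1) by (intro finite_chain_Union_mem) auto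
    then show ?thesis
      by blast
  qed
  then obtain a where a: "a \<in> \<rho>" "a \<notin> \<Union>?P"
    by blast
  then have "a \<in> U"
    using True by blast
  then have "?N \<noteq> {}"
    using a PN by (auto simp: U_def)
  then have "\<Inter>?N \<in> ?N"
    using finite_C chains(2) by (intro finite_chain_Inter_mem) auto
  then obtain c where c: "c \<in> \<Inter>?N" "c \<notin> \<rho>" and N: "\<Inter>?N \<in> C"
    by blast
  have lvl_a: "lvl a = ?N"
    using a PN by (auto simp: lvl_def)
  have lvl_c: "lvl c = ?N"
    using c PN by (auto simp: lvl_def)
  have "s a = s c" "c \<in> U"
    using lvl_a lvl_c \<open>?N \<noteq> {}\<close> by (auto intro: s_cong simp: in_U_iff)
  then show ?thesis
    using a(1) c(2) \<open>a \<in> U\<close> unfolding m_def by (cases "s a \<in> \<rho>") auto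
qed

text \<open>No fibre of \<open>rep\<close> is hit twice: if \<open>b\<close> is in
  \<open>m \<rho>\<close> and \<open>p b\<close> in \<open>m \<rho>'\<close>, then
  \<open>\<rho>\<close> contains \<open>b\<close> but not \<open>s b\<close>, and
  \<open>\<rho>'\<close> contains \<open>s b\<close> but not \<open>b\<close>, which is impossible
  in a chain. So the union with \<open>S\<close> is an injective lift of a subset of the face
  \<open>\<Union>(E \<union> C)\<close>.\<close>

lemma m_Union_face:
  assumes E: "E \<in> L"
  shows "\<Union>(m ` E) \<in> link \<Sigma> S"
proof -
  let ?\<theta> = "\<Union>(E \<union> C)" and ?M = "\<Union>(m ` E) \<union> S"
  have \<theta>: "?\<theta> \<in> D"
    using E by (rule Union_L_Un_C)
  have ED: "\<rho> \<in> D" if "\<rho> \<in> E" for \<rho>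
    using E that Q_D by (auto simp: in_L_iff)
  have U\<theta>: "U \<subseteq> ?\<theta>" and S\<theta>: "S \<subseteq> ?\<theta>"
    by (auto simp: U_def in_S_iff)
  have vertex: "b \<in> \<Union>\<Sigma>" if "b \<in> ?\<theta>" for b
    using D_face[OF \<theta>] that by (rule UnionI)
  have m_vertex: "v \<in> \<Union>\<Sigma> \<and> rep v \<in> ?\<theta> \<and> v \<notin> S" if "v \<in> m \<rho>" "\<rho> \<in> E" for v \<rho>
    using that(1) ED[OF that(2)]
  proof (cases rule: m_cases)
    case 1
    then have "v \<in> ?\<theta>"
      using that by auto
    then show ?thesis
      using 1 vertex[of v] by (auto simp: in_S_iff)
  next
    case (2 b)
    then have "v \<notin> S"
      using D_rep[OF S_D] mate(2)[of b] by metis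
    then show ?thesis
      using 2 mate(1) U\<theta> by auto
  qed
  have S_rep: "rep v = v" if "v \<in> S" for v
    using D_rep[OF S_D that] .
  have inj: "inj_on rep ?M"
  proof -
    have *: "v = rep v \<or> (rep v \<in> U \<and> s (rep v) \<noteq> rep v \<and> v = p (rep v))" if "v \<in> ?M" for v
      using that S_rep by (auto elim!: m_cases[OF _ ED] dest: sym)
    have False if b: "b \<in> U" "s b \<noteq> b" and M: "b \<in> ?M" "p b \<in> ?M" for b
    proof -
      have "b \<notin> S"
        using b by (simp add: in_S_iff)
      moreover have "p b \<notin> S"
        using mate[OF b] S_rep by metis
      ultimately obtain \<rho> \<rho>' where \<rho>: "\<rho> \<in> E" "b \<in> m \<rho>" "\<rho>' \<in> E" "p b \<in> m \<rho>'"
        using M by blast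
      have "b \<in> \<rho>" "s b \<notin> \<rho>"
        using \<rho>(2) in_m_fixed[of b \<rho>] b(1) D_rep[OF U_D] by auto
      moreover have "b \<notin> \<rho>'" "s b \<in> \<rho>'"
        using mate_in_m[OF b ED[OF \<rho>(3)]] \<rho>(4) by auto
      moreover have "\<rho> \<subseteq> \<rho>' \<or> \<rho>' \<subseteq> \<rho>"
        using E \<rho> by (auto simp: in_L_iff chain_def)
      ultimately show False
        by blast
    qed
    then show ?thesis
      using * unfolding inj_on_def by metis
  qed
  have "rep ` ?M \<subseteq> ?\<theta>"
  proof
    fix b assume "b \<in> rep ` ?M"
    then obtain v where "v \<in> ?M" "b = rep v"
      by (rule imageE)
    then show "b \<in> ?\<theta>"
      using m_vertex[of v] S_rep[of v] subsetD[OF S\<theta>, of v] by (elim UnE UN_E) simp_all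
  qed
  then have "rep ` ?M \<in> \<Sigma>"
    using D_face[OF \<theta>] subset_face by blast
  moreover have "?M \<subseteq> \<Union>\<Sigma>"
    using m_vertex S\<theta> vertex by blast
  ultimately have M: "?M \<in> \<Sigma>"
    using face_if_rep_image_face[OF inj] by blast
  then have "\<Union>(m ` E) \<in> \<Sigma>"
    by (rule subset_face) blast
  then show ?thesis
    using M m_vertex by (auto simp: link_def)
qed

text \<open>\<open>E\<close> and \<open>C\<close> together form a chain of nonempty sets, so the
  face \<open>\<Union>(E \<union> C)\<close> has at least \<open>card E + card C\<close> vertices;
  at most \<open>card C\<close> of them are lost by removing \<open>S\<close>.\<close>

lemma complex_dim_link_le:
  assumes fd: "finite_dimensional \<Sigma>"
  shows "complex_dim L \<le> complex_dim (link \<Sigma> S)"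
proof -
  have fin: "finite (face_dim ` link \<Sigma> S)"
  proof -
    obtain n where "\<And>\<sigma>. \<sigma> \<in> \<Sigma> \<Longrightarrow> face_dim \<sigma> \<le> n"
      using fd by (auto simp: finite_dimensional_def)
    then have "face_dim ` link \<Sigma> S \<subseteq> {-1..n}"
      by (auto simp: link_def face_dim_def)
    then show ?thesis
      by (rule finite_subset) simp
  qed
  have bound: "face_dim E \<le> complex_dim (link \<Sigma> S)" if E: "E \<in> L" for E
  proof -
    let ?\<theta> = "\<Union>(E \<union> C)"
    have \<theta>: "?\<theta> \<in> D"
      using E by (rule Union_L_Un_C)
    have "S \<subseteq> ?\<theta>"
      by (auto simp: U_def in_S_iff)
    then have "?\<theta> - S \<in> link \<Sigma> S"
      using D_face[OF \<theta>] D_face[OF D_subset[OF \<theta>, of "?\<theta> - S"]]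
      by (auto simp: link_def Un_absorb2)
    moreover have "card E \<le> card (?\<theta> - S)"
    proof -
      have EC: "finite \<rho> \<and> \<rho> \<noteq> {}" if "\<rho> \<in> E \<union> C" for \<rho>
      proof (cases "\<rho> \<in> C")
        case True
        then show ?thesis
          using C_nonempty D_finite[OF C_D] by blast
      next
        case False
        then have "\<rho> \<in> Q"
          using that E by (auto simp: in_L_iff)
        then show ?thesis
          using Q_nonempty D_finite[OF Q_D] by blast
      qed
      have finite_EC: "finite (E \<union> C)"
        using E finite_C by (simp add: in_L_iff)
      have "E \<inter> C = {}"
        using E Q_notin_C by (auto simp: in_L_iff)
      then have "card E + card C = card (E \<union> C)"
        using E finite_C by (simp add: in_L_iff card_Un_disjoint)
      also have "\<dots> \<le> card ?\<theta>"
        using finite_EC chain_L_Un_C[OF E] EC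
        by (intro card_chain_le_card_Union) auto
      also have "card ?\<theta> = card (?\<theta> - S) + card S"
        using \<open>S \<subseteq> ?\<theta>\<close> D_finite[OF \<theta>] D_finite[OF S_D] by (simp add: card_Diff_subset card_mono)
      finally show ?thesis
        using card_S by linarith
    qed
    ultimately show ?thesis
      unfolding complex_dim_def using fin
      by (intro order.trans[OF _ Max_ge[OF fin imageI]]) (auto simp: face_dim_def)
  qed
  have "finite (face_dim ` L)"
  proof (rule finite_subset)
    show "face_dim ` L \<subseteq> {-1..complex_dim (link \<Sigma> S)}"
      using bound by (auto simp: face_dim_def)
  qed simp
  then show ?thesis
    unfolding complex_dim_def[of L] using bound empty_in_L by (subst Max_le_iff) auto
qed

end

section \<open>The retraction\<close>

lemma closed_simplex_nonneg: "z \<in> closed_simplex \<sigma> \<Longrightarrow> 0 \<le> z v"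
  and closed_simplex_zero: "z \<in> closed_simplex \<sigma> \<Longrightarrow> v \<notin> \<sigma> \<Longrightarrow> z v = 0"
  and closed_simplex_sum: "z \<in> closed_simplex \<sigma> \<Longrightarrow> sum z \<sigma> = 1"
  by (auto simp: closed_simplex_def)

lemma closed_simplex_finite: "z \<in> closed_simplex \<sigma> \<Longrightarrow> finite \<sigma>"
  using closed_simplex_sum by (metis sum.infinite zero_neq_one)

lemma closed_simplex_support:
  assumes z: "z \<in> closed_simplex \<sigma>"
  shows "z \<in> closed_simplex {v. z v \<noteq> 0}" "{v. z v \<noteq> 0} \<subseteq> \<sigma>" "{v. z v \<noteq> 0} \<noteq> {}"
proof -
  show sub: "{v. z v \<noteq> 0} \<subseteq> \<sigma>"
    using closed_simplex_zero[OF z] by auto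
  have "sum z {v. z v \<noteq> 0} = sum z \<sigma>"
    using sub closed_simplex_finite[OF z] by (intro sum.mono_neutral_left) auto
  then have "sum z {v. z v \<noteq> 0} = 1"
    using closed_simplex_sum[OF z] by simp
  then show "z \<in> closed_simplex {v. z v \<noteq> 0}"
    using closed_simplex_nonneg[OF z] by (simp add: closed_simplex_def)
  show "{v. z v \<noteq> 0} \<noteq> {}"
    using \<open>sum z {v. z v \<noteq> 0} = 1\<close> by (metis sum.empty zero_neq_one)
qed

context transversal_chain
begin

text \<open>Every vertex over \<open>b\<close> other than \<open>b\<close> counts as negative, not
  just \<open>p b\<close>: the orbit may be larger than two, and its further vertices are folded
  onto the antipode.\<close>

definition sign :: "'a \<Rightarrow> 'a \<Rightarrow> real" where
  "sign b v = (if b \<in> U \<and> v \<noteq> b then - 1 else 1)"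

text \<open>Vanishes exactly on the part of the link of \<open>S\<close> that folds onto the cross-polytope. It is
  subtracted below at all of \<open>U - S\<close> at once: off that part some \<open>b \<in> U - S\<close> has \<open>z b = 0\<close>, so the
  coordinates on \<open>U\<close> cannot all cancel.\<close>

definition err :: "('a \<Rightarrow> real) \<Rightarrow> real" where
  "err z = min 1 (\<Sum>\<eta> | \<eta> \<subseteq> {v. z v \<noteq> 0} \<and> rep ` \<eta> \<union> U \<notin> \<Sigma>. \<Prod>v\<in>\<eta>. z v)"

text \<open>Apart from the last summand the value lies in \<open>[-2, 1]\<close>, so the factor 4 orders the differences of
  consecutive members of \<open>C\<close> strictly by height.\<close>

definition height :: "('a \<Rightarrow> real) \<Rightarrow> 'a \<Rightarrow> real" where
  "height z b = (\<Sum>v | z v \<noteq> 0 \<and> rep v = b. sign b v * z v)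
     - (if b \<in> U \<and> s b \<noteq> b then err z else 0) + 4 * real (card (lvl b))"

text \<open>On the link of \<open>S\<close> the members of \<open>C\<close> always have a positive
  gap, and some level sets may fail to be faces; both kinds are dropped by asking for
  \<open>Q\<close>. The factor \<open>card (m \<rho>)\<close> compensates for the equal distribution
  of mass over the vertices of \<open>m \<rho>\<close>.\<close>

definition weight :: "('a \<Rightarrow> real) \<Rightarrow> 'a set \<Rightarrow> real" where
  "weight z \<rho> = (if \<rho> \<in> Q then gap (height z) \<rho> * real (card (m \<rho>)) else 0)"

definition retr :: "('a \<Rightarrow> real) \<Rightarrow> 'a set \<Rightarrow> real" where
  "retr z \<rho> = weight z \<rho> / (\<Sum>\<rho>' | weight z \<rho>' \<noteq> 0. weight z \<rho>')"

lemma card_m_pos: "\<rho> \<in> Q \<Longrightarrow> 0 < card (m \<rho>)"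
  using m_nonempty finite_m Q_D by (auto simp: card_gt_0_iff)

lemma weight_nonneg: "0 \<le> weight z \<rho>"
  by (simp add: weight_def gap_nonneg)

lemma weight_nonzero_iff: "weight z \<rho> \<noteq> 0 \<longleftrightarrow> \<rho> \<in> Q \<and> 0 < gap (height z) \<rho>"
  using card_m_pos[of \<rho>] gap_nonneg[of "height z" \<rho>] by (auto simp: weight_def)

lemma lvl_less: "lvl a \<subset> lvl c \<Longrightarrow> card (lvl a) < card (lvl c)"
  by (rule psubset_card_mono[OF finite_lvl])

lemma lvl_subset_if_card_le: "card (lvl a) \<le> card (lvl c) \<Longrightarrow> lvl a \<subseteq> lvl c"
  using lvl_total[of a c] lvl_less[of c a] by auto

section \<open>Heights and level sets over a fixed simplex of the link\<close>

context
  fixes \<sigma> z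
  assumes \<sigma>: "\<sigma> \<in> link \<Sigma> S" and z: "z \<in> closed_simplex \<sigma>"
begin

lemma finite_\<sigma>: "finite \<sigma>"
  by (rule closed_simplex_finite[OF z])

lemma \<sigma>_face: "\<sigma> \<in> \<Sigma>" "\<sigma> \<union> S \<in> \<Sigma>" "\<sigma> \<inter> S = {}"
  using \<sigma> by (auto simp: link_def)

text \<open>The index set in \<open>err_def\<close> varies with \<open>z\<close>. Over one simplex
  it can be made constant, since each added monomial has a vanishing factor, and then
  \<open>err\<close> is visibly continuous there. The other rules named \<open>_on\<close> serve the
  same end.\<close>

lemma err_on: "err z = min 1 (\<Sum>\<eta> | \<eta> \<subseteq> \<sigma> \<and> rep ` \<eta> \<union> U \<notin> \<Sigma>. \<Prod>v\<in>\<eta>. z v)"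
proof -
  have "(\<Sum>\<eta> | \<eta> \<subseteq> {v. z v \<noteq> 0} \<and> rep ` \<eta> \<union> U \<notin> \<Sigma>. \<Prod>v\<in>\<eta>. z v)
      = (\<Sum>\<eta> | \<eta> \<subseteq> \<sigma> \<and> rep ` \<eta> \<union> U \<notin> \<Sigma>. \<Prod>v\<in>\<eta>. z v)"
  proof (rule sum.mono_neutral_left)
    show "finite {\<eta>. \<eta> \<subseteq> \<sigma> \<and> rep ` \<eta> \<union> U \<notin> \<Sigma>}"
      using finite_\<sigma> by simp
    show "{\<eta>. \<eta> \<subseteq> {v. z v \<noteq> 0} \<and> rep ` \<eta> \<union> U \<notin> \<Sigma>} \<subseteq> {\<eta>. \<eta> \<subseteq> \<sigma> \<and> rep ` \<eta> \<union> U \<notin> \<Sigma>}"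
      using closed_simplex_support(2)[OF z] by auto
    show "\<forall>\<eta>\<in>{\<eta>. \<eta> \<subseteq> \<sigma> \<and> rep ` \<eta> \<union> U \<notin> \<Sigma>} - {\<eta>. \<eta> \<subseteq> {v. z v \<noteq> 0} \<and> rep ` \<eta> \<union> U \<notin> \<Sigma>}.
        (\<Prod>v\<in>\<eta>. z v) = 0"
    proof
      fix \<eta> assume \<eta>: "\<eta> \<in> {\<eta>. \<eta> \<subseteq> \<sigma> \<and> rep ` \<eta> \<union> U \<notin> \<Sigma>} - {\<eta>. \<eta> \<subseteq> {v. z v \<noteq> 0} \<and> rep ` \<eta> \<union> U \<notin> \<Sigma>}"
      then have "finite \<eta>" "\<exists>v\<in>\<eta>. z v = 0"
        using finite_\<sigma> finite_subset by auto
      then show "(\<Prod>v\<in>\<eta>. z v) = 0"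
        by (rule prod_zero)
    qed
  qed
  then show ?thesis
    by (simp add: err_def)
qed

lemma err_bounds: "0 \<le> err z" "err z \<le> 1"
  using closed_simplex_nonneg[OF z] by (auto simp: err_def intro!: sum_nonneg prod_nonneg)

lemma err_zero:
  assumes "rep ` {v. z v \<noteq> 0} \<union> U \<in> \<Sigma>"
  shows "err z = 0"
proof -
  have "rep ` \<eta> \<union> U \<in> \<Sigma>" if "\<eta> \<subseteq> {v. z v \<noteq> 0}" for \<eta>
    by (rule subset_face[OF assms]) (use that in auto)
  then have none: "{\<eta>. \<eta> \<subseteq> {v. z v \<noteq> 0} \<and> rep ` \<eta> \<union> U \<notin> \<Sigma>} = {}"
    by auto
  show ?thesis
    unfolding err_def none by simp
qed

text \<open>The support of \<open>z\<close> is itself one of the index sets, and its monomial is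
  positive.\<close>

lemma err_pos:
  assumes "rep ` {v. z v \<noteq> 0} \<union> U \<notin> \<Sigma>"
  shows "0 < err z"
proof -
  let ?N = "{\<eta>. \<eta> \<subseteq> {v. z v \<noteq> 0} \<and> rep ` \<eta> \<union> U \<notin> \<Sigma>}"
  have "finite {v. z v \<noteq> 0}"
    by (rule finite_subset[OF closed_simplex_support(2)[OF z] finite_\<sigma>])
  then have "finite ?N"
    by simp
  moreover have "{v. z v \<noteq> 0} \<in> ?N"
    using assms by simp
  moreover have "0 < (\<Prod>v\<in>{v. z v \<noteq> 0}. z v)"
  proof (rule prod_pos)
    fix v assume "v \<in> {v. z v \<noteq> 0}"
    then show "0 < z v"
      using closed_simplex_nonneg[OF z, of v] by simp
  qed
  ultimately have "0 < (\<Sum>\<eta>\<in>?N. \<Prod>v\<in>\<eta>. z v)"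
  proof (rule sum_pos2)
    show "0 \<le> (\<Prod>v\<in>\<eta>. z v)" for \<eta>
      by (intro prod_nonneg closed_simplex_nonneg[OF z])
  qed
  then show ?thesis
    by (simp add: err_def)
qed

lemma height_on:
  "height z b = (\<Sum>v | v \<in> \<sigma> \<and> rep v = b. sign b v * z v)
     - (if b \<in> U \<and> s b \<noteq> b then err z else 0) + 4 * real (card (lvl b))"
proof -
  have "(\<Sum>v | z v \<noteq> 0 \<and> rep v = b. sign b v * z v) = (\<Sum>v | v \<in> \<sigma> \<and> rep v = b. sign b v * z v)"
    using finite_\<sigma> closed_simplex_zero[OF z] by (intro sum.mono_neutral_left) auto
  then show ?thesis
    by (simp add: height_def)
qed

lemma height_outside:
  assumes "b \<notin> U \<union> rep ` \<sigma>"
  shows "height z b = 0"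
proof -
  have none: "{v. v \<in> \<sigma> \<and> rep v = b} = {}" and "b \<notin> U" and "lvl b = {}"
    using assms in_U_iff by auto
  then show ?thesis
    unfolding height_on none by simp
qed

text \<open>The signed sum is bounded by the total mass 1, and \<open>err z\<close> lies between 0
  and 1. Off \<open>U\<close> all signs are positive and nothing is subtracted.\<close>

lemma height_bounds:
  "height z b \<le> 4 * real (card (lvl b)) + 1"
  "4 * real (card (lvl b)) - 2 \<le> height z b"
  "b \<notin> U \<Longrightarrow> 0 \<le> height z b"
proof -
  let ?A = "{v. v \<in> \<sigma> \<and> rep v = b}"
  have "\<bar>\<Sum>v\<in>?A. sign b v * z v\<bar> \<le> (\<Sum>v\<in>?A. \<bar>sign b v * z v\<bar>)"
    by (rule sum_abs)
  also have "\<dots> = (\<Sum>v\<in>?A. z v)"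
    using closed_simplex_nonneg[OF z] by (intro sum.cong) (auto simp: sign_def)
  also have "\<dots> \<le> sum z \<sigma>"
    using closed_simplex_nonneg[OF z] finite_\<sigma> by (intro sum_mono2) auto
  finally have "\<bar>\<Sum>v\<in>?A. sign b v * z v\<bar> \<le> 1"
    using closed_simplex_sum[OF z] by simp
  then show "height z b \<le> 4 * real (card (lvl b)) + 1"
    "4 * real (card (lvl b)) - 2 \<le> height z b"
    unfolding height_on using err_bounds by auto
  assume "b \<notin> U"
  then show "0 \<le> height z b"
    unfolding height_on using closed_simplex_nonneg[OF z]
    by (auto simp: sign_def intro!: add_nonneg_nonneg sum_nonneg)
qed

text \<open>Intervals of length 3 shifted by distinct multiples of 4 are disjoint.\<close>

lemma height_less:
  assumes "card (lvl a) < card (lvl c)"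
  shows "height z a < height z c"
proof -
  have "4 * real (card (lvl a)) + 4 \<le> 4 * real (card (lvl c))"
    using assms by linarith
  then show ?thesis
    using height_bounds(1)[of a] height_bounds(2)[of c] by linarith
qed

lemma finite_W: "finite (U \<union> rep ` \<sigma>)"
  using finite_\<sigma> D_finite[OF U_D] by simp

lemma finite_range_height: "finite (range (height z))"
proof (rule finite_subset)
  show "range (height z) \<subseteq> insert 0 (height z ` (U \<union> rep ` \<sigma>))"
    using height_outside by blast
qed (use finite_W in simp)

lemma gap_height_pos_iff:
  assumes "\<rho> \<in> Q"
  shows "0 < gap (height z) \<rho> \<longleftrightarrow>
    (\<forall>a\<in>\<rho>. 0 < height z a) \<and> (\<forall>a\<in>\<rho>. \<forall>c. c \<notin> \<rho> \<longrightarrow> height z c < height z a)"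
  using assms by (intro gap_pos_iff finite_range_height D_finite Q_D Q_nonempty)

text \<open>A set with positive gap is an upper level set of the height at a positive level; such
  sets are nested and avoid the vertices of height 0. The power set depends on
  \<open>\<sigma>\<close> only, which provides the finitely many target simplices for
  \<open>continuous_map_realizationI\<close>.\<close>

lemma weight_support: "{\<rho>. weight z \<rho> \<noteq> 0} \<in> {E \<in> L. E \<subseteq> Pow (U \<union> rep ` \<sigma>)}"
proof -
  let ?E = "{\<rho>. weight z \<rho> \<noteq> 0}"
  have EQ: "?E \<subseteq> Q"
    using weight_nonzero_iff by auto
  have pos: "(\<forall>a\<in>\<rho>. 0 < height z a) \<and> (\<forall>a\<in>\<rho>. \<forall>c. c \<notin> \<rho> \<longrightarrow> height z c < height z a)"
    if "\<rho> \<in> ?E" for \<rho>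
    using that weight_nonzero_iff gap_height_pos_iff by auto
  have EW: "?E \<subseteq> Pow (U \<union> rep ` \<sigma>)"
  proof (intro subsetI PowI)
    fix \<rho> a assume "\<rho> \<in> ?E" "a \<in> \<rho>"
    then have "0 < height z a"
      using pos by blast
    then show "a \<in> U \<union> rep ` \<sigma>"
      using height_outside by (metis less_irrefl)
  qed
  moreover have "Complete_Partial_Order.chain (\<subseteq>) ?E"
    unfolding chain_def
  proof (intro ballI)
    fix \<rho> \<rho>' assume \<rho>: "\<rho> \<in> ?E" "\<rho>' \<in> ?E"
    show "\<rho> \<subseteq> \<rho>' \<or> \<rho>' \<subseteq> \<rho>"
    proof (rule ccontr)
      assume "\<not> (\<rho> \<subseteq> \<rho>' \<or> \<rho>' \<subseteq> \<rho>)"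
      then obtain a c where "a \<in> \<rho>" "a \<notin> \<rho>'" "c \<in> \<rho>'" "c \<notin> \<rho>"
        by blast
      then have "height z c < height z a" "height z a < height z c"
        using pos[OF \<rho>(1)] pos[OF \<rho>(2)] by auto
      then show False
        by simp
    qed
  qed
  moreover have "finite ?E"
    using EW finite_W finite_subset by blast
  ultimately show ?thesis
    using EQ by (simp add: in_L_iff)
qed

text \<open>Comparability with \<open>C\<close> comes from heights respecting levels: the level set
  at \<open>t\<close> lies inside every member of \<open>C\<close> that contains \<open>t\<close>,
  and contains every member that does not.\<close>

lemma upper_level_set:
  assumes t: "0 < height z t" and D: "{b. height z t \<le> height z b} \<in> D"
    and C: "{b. height z t \<le> height z b} \<notin> C"
  shows "weight z {b. height z t \<le> height z b} \<noteq> 0"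
proof -
  let ?\<rho> = "{b. height z t \<le> height z b}"
  have "?\<rho> \<subseteq> \<tau> \<or> \<tau> \<subseteq> ?\<rho>" if \<tau>: "\<tau> \<in> C" for \<tau>
  proof (cases "t \<in> \<tau>")
    case True
    have "b \<in> \<tau>" if "b \<in> ?\<rho>" for b
    proof -
      have "\<not> card (lvl b) < card (lvl t)"
        using that height_less[of b t] by auto
      then have "lvl t \<subseteq> lvl b"
        by (intro lvl_subset_if_card_le) simp
      then show ?thesis
        using True \<tau> by (auto simp: lvl_def)
    qed
    then show ?thesis
      by blast
  next
    case False
    have "b \<in> ?\<rho>" if "b \<in> \<tau>" for b
    proof -
      have "\<not> lvl b \<subseteq> lvl t"
        using False \<tau> that by (auto simp: lvl_def)
      then have "lvl t \<subset> lvl b"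
        using lvl_total[of b t] by blast
      then show ?thesis
        using height_less[OF lvl_less, of t b] by simp
    qed
    then show ?thesis
      by blast
  qed
  moreover have "?\<rho> \<noteq> {}"
    by blast
  ultimately have Q: "?\<rho> \<in> Q"
    using D C by (simp add: Q_def)
  then have "0 < gap (height z) ?\<rho>"
    using t by (subst gap_height_pos_iff) auto
  then show ?thesis
    using Q weight_nonzero_iff by blast
qed

text \<open>\<open>rep\<close> fixes \<open>S\<close> pointwise and is injective on the face
  \<open>\<sigma> \<union> S\<close>, so a vertex of \<open>\<sigma>\<close> over \<open>S\<close>
  would itself lie in \<open>S\<close>.\<close>

lemma rep_\<sigma>_notin_S:
  assumes "v \<in> \<sigma>" shows "rep v \<notin> S"
proof
  assume S: "rep v \<in> S"
  then have "rep (rep v) = rep v" "rep v \<in> \<sigma> \<union> S"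
    by (auto simp: rep_rep)
  then have "rep v = v"
    using inj_on_rep[OF \<sigma>_face(2)] assms by (auto simp: inj_on_def)
  then show False
    using S assms \<sigma>_face(3) by auto
qed

lemma height_S:
  assumes "b \<in> S"
  shows "height z b = 4 * real (card (lvl b))"
proof -
  have none: "{v. v \<in> \<sigma> \<and> rep v = b} = {}"
    using rep_\<sigma>_notin_S assms by auto
  show ?thesis
    unfolding height_on none using assms in_S_iff by simp
qed

lemma height_single:
  assumes "v \<in> \<sigma>"
  shows "height z (rep v) = sign (rep v) v * z v
     - (if rep v \<in> U then err z else 0) + 4 * real (card (lvl (rep v)))"
proof -
  have single: "{v'. v' \<in> \<sigma> \<and> rep v' = rep v} = {v}"
    using inj_on_rep[OF \<sigma>_face(1)] assms by (auto simp: inj_on_def)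
  have "rep v \<in> U \<and> s (rep v) \<noteq> rep v \<longleftrightarrow> rep v \<in> U"
    using rep_\<sigma>_notin_S[OF assms] in_S_iff by auto
  then show ?thesis
    unfolding height_on single by simp
qed

text \<open>The upper level set at the higher of \<open>t\<close> and \<open>s t\<close> stays
  inside \<open>U\<close>, hence is a face; it separates \<open>t\<close> from \<open>s t\<close>,
  which no member of \<open>C\<close> does.\<close>

lemma weight_nonzero_of_uneven_block:
  assumes t: "t \<in> U" "height z t \<noteq> height z (s t)"
  shows "{\<rho>. weight z \<rho> \<noteq> 0} \<noteq> {}"
proof -
  define t0 where "t0 = (if height z t > height z (s t) then t else s t)"
  let ?\<rho> = "{b. height z t0 \<le> height z b}"
  have t0: "lvl t0 = lvl t"
    by (simp add: t0_def lvl_s)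
  then have "0 < card (lvl t0)"
    using t(1) finite_lvl by (auto simp: in_U_iff card_gt_0_iff)
  then have "1 \<le> real (card (lvl t0))"
    by simp
  then have pos: "0 < height z t0"
    using height_bounds(2)[of t0] by linarith
  have "?\<rho> \<subseteq> U"
  proof
    fix b assume "b \<in> ?\<rho>"
    then have "\<not> card (lvl b) < card (lvl t0)"
      using height_less[of b t0] by auto
    then have "lvl b \<noteq> {}"
      using \<open>0 < card (lvl t0)\<close> by auto
    then show "b \<in> U"
      by (simp add: in_U_iff)
  qed
  then have D: "?\<rho> \<in> D"
    by (rule D_subset[OF U_D])
  have "?\<rho> \<notin> C"
  proof
    assume mem: "?\<rho> \<in> C"
    have "t \<in> \<tau> \<longleftrightarrow> s t \<in> \<tau>" if "\<tau> \<in> C" for \<tau>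
      using lvl_s[of t] that by (auto simp: lvl_def)
    from this[OF mem] have "t \<in> ?\<rho> \<longleftrightarrow> s t \<in> ?\<rho>" .
    then show False
      using t(2) by (auto simp: t0_def split: if_splits)
  qed
  then show ?thesis
    using upper_level_set[OF pos D] by blast
qed

text \<open>If the height is constant on each level inside \<open>U\<close>, it equals the offset
  there. A positive \<open>err z\<close> would push some vertex of \<open>U\<close> below its
  offset, so the support folds to a face together with \<open>U\<close>. Then all mass lies off
  \<open>U\<close>, and the level set of any vertex over the support is a face that sticks out of
  \<open>U\<close>.\<close>

lemma weight_nonzero: "{\<rho>. weight z \<rho> \<noteq> 0} \<noteq> {}"
proof (cases "\<exists>t\<in>U. height z t \<noteq> height z (s t)")
  case True
  then show ?thesis
    using weight_nonzero_of_uneven_block by blast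
next
  case False
  then have flat: "height z t = 4 * real (card (lvl t))" if "t \<in> U" for t
    using that height_S[of "s t"] lvl_s[of t] by (simp add: S_def)
  have face: "rep ` {v. z v \<noteq> 0} \<union> U \<in> \<Sigma>"
  proof (rule ccontr)
    assume nonface: "rep ` {v. z v \<noteq> 0} \<union> U \<notin> \<Sigma>"
    then have err: "0 < err z"
      by (rule err_pos)
    have "\<exists>t\<in>U - S. z t = 0"
    proof (rule ccontr)
      assume "\<not> (\<exists>t\<in>U - S. z t = 0)"
      then have "{v. z v \<noteq> 0} \<union> U \<subseteq> \<sigma> \<union> S"
        using closed_simplex_zero[OF z] by auto
      then have "{v. z v \<noteq> 0} \<union> U \<in> \<Sigma>"
        by (rule subset_face[OF \<sigma>_face(2)])
      then have "rep ` ({v. z v \<noteq> 0} \<union> U) \<in> \<Sigma>"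
        by (rule D_face[OF rep_image_D])
      moreover have "rep ` U = U"
        using D_rep[OF U_D] by simp
      ultimately show False
        using nonface by (simp add: image_Un)
    qed
    then obtain t where t: "t \<in> U" "t \<notin> S" "z t = 0"
      by blast
    have "s t \<noteq> t"
      using t by (simp add: in_S_iff)
    \<comment> \<open>The vertex \<open>t\<close> itself has coordinate 0, and every other vertex
      over \<open>t\<close> enters with sign -1.\<close>
    moreover have "(\<Sum>v | v \<in> \<sigma> \<and> rep v = t. sign t v * z v) \<le> 0"
    proof (rule sum_nonpos)
      fix v
      show "sign t v * z v \<le> 0"
        using t closed_simplex_nonneg[OF z, of v] by (cases "v = t") (simp_all add: sign_def)
    qed
    ultimately have "height z t < 4 * real (card (lvl t))"
      unfolding height_on using t err by simp
    then show False
      using flat[OF t(1)] by simp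
  qed
  then have err: "err z = 0"
    by (rule err_zero)
  let ?\<sigma> = "{v. z v \<noteq> 0}"
  obtain v where v: "z v \<noteq> 0"
    using closed_simplex_support(3)[OF z] by blast
  then have "v \<in> \<sigma>"
    using closed_simplex_support(2)[OF z] by blast
  have notin: "rep v \<notin> U"
  proof
    assume "rep v \<in> U"
    then have "sign (rep v) v * z v = 0"
      using flat height_single[OF \<open>v \<in> \<sigma>\<close>] err by simp
    then show False
      using v by (auto simp: sign_def split: if_splits)
  qed
  then have "lvl (rep v) = {}"
    by (simp add: in_U_iff)
  then have h: "height z (rep v) = z v"
    using height_single[OF \<open>v \<in> \<sigma>\<close>] notin by (simp add: sign_def)
  let ?\<rho> = "{b. height z (rep v) \<le> height z b}"
  have pos: "0 < height z (rep v)"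
    using h v closed_simplex_nonneg[OF z, of v] by simp
  have "?\<rho> \<subseteq> rep ` ?\<sigma> \<union> U"
  proof
    fix b assume "b \<in> ?\<rho>"
    then have "height z b \<noteq> 0"
      using pos by auto
    show "b \<in> rep ` ?\<sigma> \<union> U"
    proof (rule ccontr)
      assume b: "b \<notin> rep ` ?\<sigma> \<union> U"
      then have none: "{v. z v \<noteq> 0 \<and> rep v = b} = {}" and "lvl b = {}"
        by (auto simp: in_U_iff)
      then have "height z b = 0"
        unfolding height_def none using b by simp
      then show False
        using \<open>height z b \<noteq> 0\<close> by simp
    qed
  qed
  moreover have "rep ` ?\<sigma> \<union> U \<in> D"
    unfolding D_def using face rep_rep D_rep[OF U_D] by auto
  ultimately have D: "?\<rho> \<in> D"
    using D_subset by blast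
  have "rep v \<in> ?\<rho>"
    by simp
  then have "?\<rho> \<notin> C"
    using notin unfolding U_def by blast
  then show ?thesis
    using upper_level_set[OF pos D] by blast
qed

lemma weight_sum_pos: "0 < (\<Sum>\<rho> | weight z \<rho> \<noteq> 0. weight z \<rho>)"
proof (rule sum_pos)
  show "finite {\<rho>. weight z \<rho> \<noteq> 0}"
    using weight_support in_L_iff by blast
qed (use weight_nonzero weight_nonneg in \<open>auto simp: order_less_le\<close>)

lemma retr_closed_simplex: "retr z \<in> closed_simplex {\<rho>. weight z \<rho> \<noteq> 0}"
proof -
  have "(\<Sum>\<rho> | weight z \<rho> \<noteq> 0. retr z \<rho>) = 1"
    using weight_sum_pos by (simp add: retr_def sum_divide_distrib[symmetric])
  then show ?thesis
    using weight_nonneg weight_sum_pos by (auto simp: closed_simplex_def retr_def)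
qed

lemma weight_on:
  assumes \<rho>: "\<rho> \<in> Q"
  shows "weight z \<rho> = max 0 (Min (height z ` \<rho>) - Max (insert 0 (height z ` (U \<union> rep ` \<sigma> - \<rho>))))
    * real (card (m \<rho>))"
proof -
  have "insert 0 (height z ` (- \<rho>)) = insert 0 (height z ` (U \<union> rep ` \<sigma> - \<rho>))"
    using height_outside by auto
  then show ?thesis
    using \<rho> by (simp add: weight_def gap_def)
qed

lemma weight_outside: "\<rho> \<notin> Q \<inter> Pow (U \<union> rep ` \<sigma>) \<Longrightarrow> weight z \<rho> = 0"
  using weight_support weight_nonzero_iff[of z \<rho>] by auto

lemma retr_on: "retr z \<rho> = weight z \<rho> / (\<Sum>\<rho>'\<in>Q \<inter> Pow (U \<union> rep ` \<sigma>). weight z \<rho>')"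
proof -
  have "(\<Sum>\<rho>' | weight z \<rho>' \<noteq> 0. weight z \<rho>') = (\<Sum>\<rho>'\<in>Q \<inter> Pow (U \<union> rep ` \<sigma>). weight z \<rho>')"
    using finite_W weight_outside by (intro sum.mono_neutral_left) auto
  then show ?thesis
    by (simp add: retr_def)
qed

end

section \<open>Continuity of the retraction\<close>

lemma continuous_on_height:
  assumes \<sigma>: "\<sigma> \<in> link \<Sigma> S"
  shows "continuous_on (closed_simplex \<sigma>) (\<lambda>z. height z b)"
proof -
  have eval: "continuous_on (closed_simplex \<sigma>) (\<lambda>z::'a \<Rightarrow> real. z v)" for v
    by (rule continuous_on_subset[OF continuous_on_product_coordinates subset_UNIV])
  have "continuous_on (closed_simplex \<sigma>)
      (\<lambda>z. min 1 (\<Sum>\<eta> | \<eta> \<subseteq> \<sigma> \<and> rep ` \<eta> \<union> U \<notin> \<Sigma>. \<Prod>v\<in>\<eta>. z v))"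
    by (intro continuous_on_min continuous_on_const continuous_on_sum continuous_on_prod eval)
  then have err: "continuous_on (closed_simplex \<sigma>) err"
    using err_on[OF \<sigma>] by (simp cong: continuous_on_cong)
  have err': "continuous_on (closed_simplex \<sigma>) (\<lambda>z. if b \<in> U \<and> s b \<noteq> b then err z else 0)"
    using err by (cases "b \<in> U \<and> s b \<noteq> b") auto
  have "continuous_on (closed_simplex \<sigma>) (\<lambda>z. (\<Sum>v | v \<in> \<sigma> \<and> rep v = b. sign b v * z v)
     - (if b \<in> U \<and> s b \<noteq> b then err z else 0) + 4 * real (card (lvl b)))"
    by (intro continuous_on_add continuous_on_diff continuous_on_const continuous_on_sum
        continuous_on_mult eval err')
  then show ?thesis
    using height_on[OF \<sigma>] by (simp cong: continuous_on_cong)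
qed

lemma continuous_on_weight:
  assumes \<sigma>: "\<sigma> \<in> link \<Sigma> S"
  shows "continuous_on (closed_simplex \<sigma>) (\<lambda>z. weight z \<rho>)"
proof (cases "\<rho> \<in> Q")
  case True
  let ?W = "U \<union> rep ` \<sigma>"
  have "finite \<sigma>"
    using \<sigma> finite_face by (auto simp: link_def)
  then have fin: "finite (?W - \<rho>)" "finite \<rho>"
    using D_finite[OF U_D] D_finite[OF Q_D[OF True]] by auto
  have Max: "continuous_on (closed_simplex \<sigma>) (\<lambda>z. Max (insert 0 (height z ` (?W - \<rho>))))"
  proof (cases "?W - \<rho> = {}")
    case False
    have "continuous_on (closed_simplex \<sigma>) (\<lambda>z. max 0 (Max ((\<lambda>b. height z b) ` (?W - \<rho>))))"
      using False fin(1) by (intro continuous_on_max continuous_on_const continuous_on_Max_image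
          continuous_on_height[OF \<sigma>])
    then show ?thesis
      using False fin(1) by (subst Max_insert) auto
  qed (simp only: image_empty Max_singleton continuous_on_const)
  have "continuous_on (closed_simplex \<sigma>) (\<lambda>z. max 0 (Min ((\<lambda>b. height z b) ` \<rho>)
      - Max (insert 0 (height z ` (?W - \<rho>)))) * real (card (m \<rho>)))"
    using fin(2) Q_nonempty[OF True]
    by (intro continuous_on_mult continuous_on_max continuous_on_diff continuous_on_const Max
        continuous_on_Min_image continuous_on_height[OF \<sigma>])
  then show ?thesis
    using weight_on[OF \<sigma> _ True] by (simp cong: continuous_on_cong)
qed (simp add: weight_def)

lemma continuous_map_retr: "continuous_map (realization (link \<Sigma> S)) (realization L) retr"
proof (rule continuous_map_realizationI)
  fix \<sigma> assume \<sigma>: "\<sigma> \<in> link \<Sigma> S"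
  let ?W = "U \<union> rep ` \<sigma>"
  let ?F = "{E \<in> L. E \<subseteq> Pow ?W}"
  have "finite \<sigma>"
    using \<sigma> finite_face by (auto simp: link_def)
  then have W: "finite ?W"
    using D_finite[OF U_D] by simp
  have "finite ?F"
    using W by simp
  moreover have "retr ` closed_simplex \<sigma> \<subseteq> (\<Union>E\<in>?F. closed_simplex E)"
  proof
    fix y assume "y \<in> retr ` closed_simplex \<sigma>"
    then obtain z where z: "z \<in> closed_simplex \<sigma>" "y = retr z"
      by (rule imageE)
    then show "y \<in> (\<Union>E\<in>?F. closed_simplex E)"
      unfolding z(2)
      by (intro UN_I[of "{\<rho>. weight z \<rho> \<noteq> 0}"] weight_support[OF \<sigma> z(1)]
          retr_closed_simplex[OF \<sigma> z(1)])
  qed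
  ultimately show "\<exists>F. finite F \<and> F \<subseteq> L \<and> retr ` closed_simplex \<sigma> \<subseteq> (\<Union>\<tau>\<in>F. closed_simplex \<tau>)"
    by (intro exI[of _ ?F]) simp
  fix \<rho>
  have "(\<Sum>\<rho>'\<in>Q \<inter> Pow ?W. weight z \<rho>') \<noteq> 0" if z: "z \<in> closed_simplex \<sigma>" for z
  proof -
    have "(\<Sum>\<rho>' | weight z \<rho>' \<noteq> 0. weight z \<rho>') = (\<Sum>\<rho>'\<in>Q \<inter> Pow ?W. weight z \<rho>')"
      using W weight_outside[OF \<sigma> z] by (intro sum.mono_neutral_left) auto
    then show ?thesis
      using weight_sum_pos[OF \<sigma> z] by simp
  qed
  then have "continuous_on (closed_simplex \<sigma>) (\<lambda>z. weight z \<rho> / (\<Sum>\<rho>'\<in>Q \<inter> Pow ?W. weight z \<rho>'))"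
    by (intro continuous_on_divide continuous_on_sum continuous_on_weight[OF \<sigma>]) simp
  then show "continuous_on (closed_simplex \<sigma>) (\<lambda>z. retr z \<rho>)"
    using retr_on[OF \<sigma>] by (simp cong: continuous_on_cong)
qed

end

section \<open>The embedding\<close>

context transversal_chain
begin

definition coeff :: "('a set \<Rightarrow> real) \<Rightarrow> 'a set \<Rightarrow> real" where
  "coeff y \<rho> = y \<rho> / real (card (m \<rho>))"

definition embed :: "('a set \<Rightarrow> real) \<Rightarrow> 'a \<Rightarrow> real" where
  "embed y v = (\<Sum>\<rho> | y \<rho> \<noteq> 0 \<and> v \<in> m \<rho>. coeff y \<rho>)"

text \<open>The function on vertices encoded by a point of the realization of \<open>L\<close>: a
  combination of the indicators of the members of a chain. On \<open>U\<close> the embedding keeps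
  it only relative to its value at the chosen vertex of each level.\<close>

definition cover :: "('a set \<Rightarrow> real) \<Rightarrow> 'a \<Rightarrow> real" where
  "cover y b = (\<Sum>\<rho> | y \<rho> \<noteq> 0 \<and> b \<in> \<rho>. coeff y \<rho>)"

text \<open>At most one vertex of \<open>m \<rho>\<close> lies over \<open>b\<close>: either
  \<open>b\<close> itself, or \<open>p b\<close> with sign -1 for \<open>b\<close> in
  \<open>U\<close>. At a chosen vertex the two indicators cancel.\<close>

lemma sum_sign:
  assumes \<rho>: "\<rho> \<in> D"
  shows "(\<Sum>v | v \<in> m \<rho> \<and> rep v = b. sign b v) = of_bool (b \<in> \<rho>) - of_bool (b \<in> U \<and> s b \<in> \<rho>)"
proof -
  have set_eq: "{v. v \<in> m \<rho> \<and> rep v = b} =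
      (if b \<in> \<rho> \<and> (b \<in> U \<longrightarrow> s b \<notin> \<rho>) then {b} else {}) \<union>
      (if b \<in> U \<and> b \<notin> \<rho> \<and> s b \<in> \<rho> then {p b} else {})" (is "?A = ?B")
  proof (intro equalityI subsetI)
    fix v assume "v \<in> ?A"
    then have v: "v \<in> m \<rho>" "rep v = b"
      by auto
    show "v \<in> ?B"
      using v(1) \<rho>
    proof (cases rule: m_cases)
      case 1
      then show ?thesis
        using v(2) by auto
    next
      case (2 b')
      then show ?thesis
        using v(2) by auto
    qed
  next
    fix v assume v: "v \<in> ?B"
    show "v \<in> ?A"
    proof (cases "b \<in> \<rho>")
      case True
      then have "v = b" "b \<in> U \<longrightarrow> s b \<notin> \<rho>"
        using v by (auto split: if_splits)
      then show ?thesis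
        using D_rep[OF \<rho> True] in_m_fixed[of b \<rho>] True by simp
    next
      case False
      then have b: "v = p b" "b \<in> U" "s b \<in> \<rho>" "s b \<noteq> b"
        using v by (auto split: if_splits)
      then show ?thesis
        using mate_in_m[OF b(2,4) \<rho>] mate(3)[OF b(2,4)] False by simp
    qed
  qed
  show ?thesis
  proof (cases "b \<in> U \<and> b \<notin> \<rho> \<and> s b \<in> \<rho>")
    case True
    then have "p b \<noteq> b"
      by (intro mate(2)) auto
    then show ?thesis
      unfolding set_eq using True by (simp add: sign_def)
  next
    case False
    then show ?thesis
      unfolding set_eq by (auto simp: sign_def)
  qed
qed

lemma rep_m_subset: "\<rho> \<in> D \<Longrightarrow> rep ` m \<rho> \<subseteq> \<rho> \<union> U"
  by (auto elim!: m_cases)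

section \<open>The retraction undoes the embedding on a fixed simplex\<close>

context
  fixes E y
  assumes E: "E \<in> L" and y: "y \<in> closed_simplex E"
begin

lemma finite_E: "finite E"
  using E by (simp add: in_L_iff)

lemma E_Q: "\<rho> \<in> E \<Longrightarrow> \<rho> \<in> Q"
  using E by (auto simp: in_L_iff)

lemma E_total: "\<rho> \<in> E \<Longrightarrow> \<rho>' \<in> E \<Longrightarrow> \<rho> \<subseteq> \<rho>' \<or> \<rho>' \<subseteq> \<rho>"
  using E by (simp add: in_L_iff chain_def)

lemma coeff_nonneg: "0 \<le> coeff y \<rho>"
  using closed_simplex_nonneg[OF y] by (simp add: coeff_def)

lemma coeff_outside: "\<rho> \<notin> E \<Longrightarrow> coeff y \<rho> = 0"
  using closed_simplex_zero[OF y] by (simp add: coeff_def)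

lemma card_m_coeff: "\<rho> \<in> Q \<Longrightarrow> real (card (m \<rho>)) * coeff y \<rho> = y \<rho>"
  using card_m_pos by (simp add: coeff_def)

lemma embed_on: "embed y v = (\<Sum>\<rho>\<in>E. of_bool (v \<in> m \<rho>) * coeff y \<rho>)"
proof -
  have "embed y v = (\<Sum>\<rho> | y \<rho> \<noteq> 0 \<and> v \<in> m \<rho>. of_bool (v \<in> m \<rho>) * coeff y \<rho>)"
    unfolding embed_def by (rule sum.cong) auto
  also have "\<dots> = (\<Sum>\<rho>\<in>E. of_bool (v \<in> m \<rho>) * coeff y \<rho>)"
  proof (rule sum.mono_neutral_left[OF finite_E])
    show "{\<rho>. y \<rho> \<noteq> 0 \<and> v \<in> m \<rho>} \<subseteq> E"
      using closed_simplex_zero[OF y] by auto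
  qed (auto simp: coeff_def)
  finally show ?thesis .
qed

lemma cover_on: "cover y b = (\<Sum>\<rho>\<in>E. of_bool (b \<in> \<rho>) * coeff y \<rho>)"
proof -
  have "cover y b = (\<Sum>\<rho> | y \<rho> \<noteq> 0 \<and> b \<in> \<rho>. of_bool (b \<in> \<rho>) * coeff y \<rho>)"
    unfolding cover_def by (rule sum.cong) auto
  also have "\<dots> = (\<Sum>\<rho>\<in>E. of_bool (b \<in> \<rho>) * coeff y \<rho>)"
  proof (rule sum.mono_neutral_left[OF finite_E])
    show "{\<rho>. y \<rho> \<noteq> 0 \<and> b \<in> \<rho>} \<subseteq> E"
      using closed_simplex_zero[OF y] by auto
  qed (auto simp: coeff_def)
  finally show ?thesis .
qed

lemma embed_closed_simplex: "embed y \<in> closed_simplex (\<Union>(m ` E))"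
proof -
  let ?M = "\<Union>(m ` E)"
  have M: "finite ?M"
    using finite_E finite_m Q_D E_Q by auto
  have "(\<Sum>v\<in>?M. embed y v) = (\<Sum>\<rho>\<in>E. \<Sum>v\<in>?M. of_bool (v \<in> m \<rho>) * coeff y \<rho>)"
    unfolding embed_on by (rule sum.swap)
  also have "\<dots> = (\<Sum>\<rho>\<in>E. y \<rho>)"
  proof (rule sum.cong[OF refl])
    fix \<rho> assume \<rho>: "\<rho> \<in> E"
    have "(\<Sum>v\<in>?M. of_bool (v \<in> m \<rho>) * coeff y \<rho>) = (\<Sum>v\<in>m \<rho>. of_bool (v \<in> m \<rho>) * coeff y \<rho>)"
      using M \<rho> by (intro sum.mono_neutral_right) auto
    then show "(\<Sum>v\<in>?M. of_bool (v \<in> m \<rho>) * coeff y \<rho>) = y \<rho>"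
      using card_m_coeff[OF E_Q[OF \<rho>]] by simp
  qed
  finally have "(\<Sum>v\<in>?M. embed y v) = 1"
    using closed_simplex_sum[OF y] by simp
  moreover have "embed y v = 0" if "v \<notin> ?M" for v
    unfolding embed_on using that by (intro sum.neutral) auto
  moreover have "0 \<le> embed y v" for v
    unfolding embed_on using coeff_nonneg by (intro sum_nonneg) simp
  ultimately show ?thesis
    unfolding closed_simplex_def by blast
qed

text \<open>The face \<open>\<Union>(E \<union> C)\<close> contains \<open>U\<close> and the
  representatives of all vertices in the support.\<close>

lemma err_embed: "err (embed y) = 0"
proof (rule err_zero[OF m_Union_face[OF E] embed_closed_simplex])
  have "rep ` \<Union>(m ` E) \<subseteq> \<Union>E \<union> U"
  proof
    fix b assume "b \<in> rep ` \<Union>(m ` E)"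
    then obtain \<rho> v where "\<rho> \<in> E" "v \<in> m \<rho>" "b = rep v"
      by blast
    then show "b \<in> \<Union>E \<union> U"
      using rep_m_subset[OF Q_D[OF E_Q], of \<rho>] by blast
  qed
  moreover have "{v. embed y v \<noteq> 0} \<subseteq> \<Union>(m ` E)"
    by (rule closed_simplex_support(2)[OF embed_closed_simplex])
  ultimately have "rep ` {v. embed y v \<noteq> 0} \<subseteq> \<Union>E \<union> U"
    by (meson image_mono subset_trans)
  then have "rep ` {v. embed y v \<noteq> 0} \<union> U \<subseteq> \<Union>(E \<union> C)"
    by (simp add: U_def)
  then show "rep ` {v. embed y v \<noteq> 0} \<union> U \<in> \<Sigma>"
    by (rule subset_face[OF D_face[OF Union_L_Un_C[OF E]]])
qed

lemma height_embed:
  "height (embed y) b = cover y b - (if b \<in> U then cover y (s b) else 0) + 4 * real (card (lvl b))"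
proof -
  let ?M = "\<Union>(m ` E)"
  let ?B = "{v. v \<in> ?M \<and> rep v = b}"
  have M: "finite ?M"
    using finite_E finite_m Q_D E_Q by auto
  have B: "finite ?B"
    by (rule finite_subset[OF _ M]) blast
  have "(\<Sum>v\<in>?B. sign b v * embed y v) = (\<Sum>v\<in>?B. \<Sum>\<rho>\<in>E. coeff y \<rho> * (of_bool (v \<in> m \<rho>) * sign b v))"
    unfolding embed_on sum_distrib_left by (intro sum.cong refl) simp
  also have "\<dots> = (\<Sum>\<rho>\<in>E. \<Sum>v\<in>?B. coeff y \<rho> * (of_bool (v \<in> m \<rho>) * sign b v))"
    by (rule sum.swap)
  also have "\<dots> = (\<Sum>\<rho>\<in>E. coeff y \<rho> * (of_bool (b \<in> \<rho>) - of_bool (b \<in> U \<and> s b \<in> \<rho>)))"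
  proof (rule sum.cong[OF refl])
    fix \<rho> assume \<rho>: "\<rho> \<in> E"
    have "(\<Sum>v\<in>?B. of_bool (v \<in> m \<rho>) * sign b v) = (\<Sum>v | v \<in> m \<rho> \<and> rep v = b. of_bool (v \<in> m \<rho>) * sign b v)"
      using B \<rho> by (intro sum.mono_neutral_right) auto
    also have "\<dots> = (\<Sum>v | v \<in> m \<rho> \<and> rep v = b. sign b v)"
      by (rule sum.cong) auto
    finally show "(\<Sum>v\<in>?B. coeff y \<rho> * (of_bool (v \<in> m \<rho>) * sign b v))
        = coeff y \<rho> * (of_bool (b \<in> \<rho>) - of_bool (b \<in> U \<and> s b \<in> \<rho>))"
      using sum_sign[OF Q_D[OF E_Q[OF \<rho>]]] by (simp add: sum_distrib_left[symmetric])
  qed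
  also have "\<dots> = cover y b - (if b \<in> U then cover y (s b) else 0)"
    unfolding cover_on by (simp add: algebra_simps sum_subtractf)
  finally show ?thesis
    unfolding height_on[OF m_Union_face[OF E] embed_closed_simplex] by (simp add: err_embed)
qed

lemma cover_nonneg: "0 \<le> cover y b"
  unfolding cover_on using coeff_nonneg by (intro sum_nonneg) simp

lemma cover_le_1: "cover y b \<le> 1"
proof -
  have "cover y b \<le> (\<Sum>\<rho>\<in>E. y \<rho>)"
    unfolding cover_on
  proof (rule sum_mono)
    fix \<rho> assume "\<rho> \<in> E"
    then have "1 \<le> real (card (m \<rho>))"
      using card_m_pos[OF E_Q] by (simp add: Suc_leI)
    then have "1 * coeff y \<rho> \<le> real (card (m \<rho>)) * coeff y \<rho>"
      using coeff_nonneg by (intro mult_right_mono) auto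
    then show "of_bool (b \<in> \<rho>) * coeff y \<rho> \<le> y \<rho>"
      using card_m_coeff[OF E_Q[OF \<open>\<rho> \<in> E\<close>]] closed_simplex_nonneg[OF y, of \<rho>] by simp
  qed
  then show ?thesis
    using closed_simplex_sum[OF y] by simp
qed

lemma coeff_le_1: "coeff y \<rho> \<le> 1"
proof (cases "\<rho> \<in> E")
  case True
  then have "\<rho> \<noteq> {}"
    using E_Q Q_nonempty by blast
  then obtain b where "b \<in> \<rho>"
    by blast
  then have "of_bool (b \<in> \<rho>) * coeff y \<rho> \<le> cover y b"
    unfolding cover_on using True finite_E coeff_nonneg by (intro member_le_sum) auto
  then show ?thesis
    using cover_le_1[of b] \<open>b \<in> \<rho>\<close> by simp
qed (simp add: coeff_outside)

lemma cover_diff: "cover y a - cover y c = (\<Sum>\<rho>\<in>E. (of_bool (a \<in> \<rho>) - of_bool (c \<in> \<rho>)) * coeff y \<rho>)"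
  unfolding cover_on by (simp add: sum_subtractf left_diff_distrib)

lemma height_embed_ge:
  assumes "b \<in> U"
  shows "3 \<le> height (embed y) b"
proof -
  have "0 < card (lvl b)"
    using assms finite_lvl in_U_iff by (simp add: card_gt_0_iff)
  then have "1 \<le> real (card (lvl b))"
    by simp
  then show ?thesis
    unfolding height_embed using assms cover_nonneg[of b] cover_le_1[of "s b"] by simp
qed

text \<open>Vertices of one level share their chosen vertex, so the subtracted terms and the offsets
  cancel.\<close>

lemma height_embed_diff_same:
  assumes "lvl a = lvl c"
  shows "height (embed y) a - height (embed y) c = cover y a - cover y c"
  unfolding height_embed using assms s_cong[OF assms] in_U_iff[of a] in_U_iff[of c] by auto

lemma height_embed_diff_less:
  assumes "lvl c \<subset> lvl a"
  shows "1 \<le> height (embed y) a - height (embed y) c"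
proof -
  have "4 * real (card (lvl c)) + 4 \<le> 4 * real (card (lvl a))"
    using lvl_less[OF assms] by linarith
  then show ?thesis
    unfolding height_embed
    using cover_nonneg[of a] cover_nonneg[of c] cover_nonneg[of "s a"] cover_nonneg[of "s c"]
      cover_le_1[of a] cover_le_1[of c] cover_le_1[of "s a"] cover_le_1[of "s c"] by auto
qed

text \<open>A vertex \<open>a\<close> of \<open>\<rho>\<close> outside all smaller members of
  \<open>E \<union> C\<close> and a vertex \<open>c\<close> outside \<open>\<rho>\<close> in all
  larger ones lie in the same members apart from \<open>\<rho>\<close>, so their heights differ by
  exactly \<open>coeff y \<rho>\<close>. Any other pair, one vertex inside \<open>\<rho>\<close> and
  one outside, differs by at least as much.\<close>

lemma gap_embed_comparable:
  assumes \<rho>: "\<rho> \<in> Q" and cmp: "\<And>\<rho>'. \<rho>' \<in> E \<Longrightarrow> \<rho> \<subseteq> \<rho>' \<or> \<rho>' \<subseteq> \<rho>"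
  shows "gap (height (embed y)) \<rho> = coeff y \<rho>"
proof -
  have cmp': "\<rho> \<subseteq> \<tau> \<or> \<tau> \<subseteq> \<rho>" if "\<tau> \<in> E \<union> C" for \<tau>
    using that cmp Q_total[OF \<rho>] by blast
  let ?P = "{\<tau> \<in> E \<union> C. \<tau> \<subset> \<rho>}" and ?N = "{\<tau> \<in> E \<union> C. \<rho> \<subset> \<tau>}"
  have fin: "finite ?P" "finite ?N"
    using finite_E finite_C by auto
  have chains: "Complete_Partial_Order.chain (\<subseteq>) ?P" "Complete_Partial_Order.chain (\<subseteq>) ?N"
    using chain_L_Un_C[OF E] by (auto simp: chain_def)
  have PN: "\<tau> \<in> ?P \<or> \<tau> \<in> ?N \<or> \<tau> = \<rho>" if "\<tau> \<in> E \<union> C" for \<tau>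
    using cmp'[OF that] that by auto
  have "\<Union>?P \<subset> \<rho>"
  proof (cases "?P = {}")
    case True
    show ?thesis
      unfolding True using Q_nonempty[OF \<rho>] by auto
  next
    case False
    then have "\<Union>?P \<in> ?P"
      using fin(1) chains(1) by (intro finite_chain_Union_mem)
    then show ?thesis
      by blast
  qed
  then obtain a where a: "a \<in> \<rho>" "a \<notin> \<Union>?P"
    by blast
  have a_mem: "a \<in> \<tau> \<longleftrightarrow> \<tau> \<in> ?N \<or> \<tau> = \<rho>" if "\<tau> \<in> E \<union> C" for \<tau>
    using PN[OF that] a that by auto
  have a_lvl: "lvl a = {\<tau> \<in> C. \<tau> \<in> ?N}"
    using a_mem Q_notin_C[OF \<rho>] unfolding lvl_def by auto
  have sum_eq: "coeff y \<rho> = (\<Sum>\<rho>'\<in>E. of_bool (\<rho>' = \<rho>) * coeff y \<rho>')"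
    using finite_E coeff_outside[of \<rho>] by (simp add: of_bool_def if_distrib[of "\<lambda>x. x * _"] sum.delta cong: if_cong)
  have lvl_mono: "lvl c' \<subseteq> lvl a'" if "a' \<in> \<rho>" "c' \<notin> \<rho>" for a' c'
    using that Q_total[OF \<rho>] unfolding lvl_def by blast
  show ?thesis
  proof (rule gap_eqI)
    show "finite \<rho>"
      using D_finite[OF Q_D[OF \<rho>]] .
    show "finite (range (height (embed y)))"
      by (rule finite_range_height[OF m_Union_face[OF E] embed_closed_simplex])
    show "0 \<le> coeff y \<rho>"
      by (rule coeff_nonneg)
    show "coeff y \<rho> \<le> height (embed y) a'" if a': "a' \<in> \<rho>" for a'
    proof (cases "a' \<in> U")
      case True
      then show ?thesis
        using height_embed_ge[OF True] coeff_le_1[of \<rho>] by simp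
    next
      case False
      have "coeff y \<rho> \<le> cover y a'"
        unfolding sum_eq cover_on using a' coeff_nonneg by (intro sum_mono) auto
      then show ?thesis
        unfolding height_embed using False by simp
    qed
    show "coeff y \<rho> \<le> height (embed y) a' - height (embed y) c'" if a': "a' \<in> \<rho>" "c' \<notin> \<rho>" for a' c'
    proof (cases "lvl a' = lvl c'")
      case True
      have "coeff y \<rho> \<le> cover y a' - cover y c'"
        unfolding sum_eq cover_diff
      proof (rule sum_mono)
        fix \<rho>' assume "\<rho>' \<in> E"
        then have "of_bool (\<rho>' = \<rho>) \<le> (of_bool (a' \<in> \<rho>') - of_bool (c' \<in> \<rho>') :: real)"
          using cmp[of \<rho>'] a' by auto
        then show "of_bool (\<rho>' = \<rho>) * coeff y \<rho>' \<le> (of_bool (a' \<in> \<rho>') - of_bool (c' \<in> \<rho>')) * coeff y \<rho>'"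
          using coeff_nonneg by (rule mult_right_mono)
      qed
      then show ?thesis
        using height_embed_diff_same[OF True] by simp
    next
      case False
      then have "lvl c' \<subset> lvl a'"
        using lvl_mono[OF a'] by blast
      then show ?thesis
        using height_embed_diff_less[of c' a'] coeff_le_1[of \<rho>] by simp
    qed
    show "a \<in> \<rho>"
      by (rule a(1))
    show "height (embed y) a = coeff y \<rho> \<or> (\<exists>c. c \<notin> \<rho> \<and> height (embed y) a - height (embed y) c = coeff y \<rho>)"
    proof (cases "?N = {}")
      \<comment> \<open>With nothing larger, \<open>a\<close> lies in no member of \<open>C\<close>,
        and in no member of \<open>E\<close> except possibly \<open>\<rho>\<close>. Its height is
        then measured against the 0 in \<open>gap_def\<close>.\<close>
      case True
      have "lvl a = {}"
        unfolding a_lvl True by simp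
      then have "a \<notin> U"
        by (simp add: in_U_iff)
      moreover have "cover y a = coeff y \<rho>"
        unfolding cover_on sum_eq using a_mem True by (intro sum.cong) auto
      ultimately show ?thesis
        unfolding height_embed using \<open>lvl a = {}\<close> by simp
    next
      case False
      then have "\<Inter>?N \<in> ?N"
        using fin(2) chains(2) by (intro finite_chain_Inter_mem)
      then obtain c where c: "c \<in> \<Inter>?N" "c \<notin> \<rho>"
        by blast
      have c_mem: "c \<in> \<tau> \<longleftrightarrow> \<tau> \<in> ?N" if "\<tau> \<in> E \<union> C" for \<tau>
        using PN[OF that] c that by auto
      have "lvl c = lvl a"
        unfolding a_lvl unfolding lvl_def using c_mem by auto
      moreover have "cover y a - cover y c = coeff y \<rho>"
        unfolding cover_diff sum_eq
      proof (intro sum.cong refl arg_cong2[of _ _ _ _ "(*)"])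
        fix \<rho>' assume "\<rho>' \<in> E"
        then show "of_bool (a \<in> \<rho>') - of_bool (c \<in> \<rho>') = (of_bool (\<rho>' = \<rho>) :: real)"
          using a_mem[of \<rho>'] c_mem[of \<rho>'] by (cases "\<rho>' = \<rho>") auto
      qed
      ultimately show ?thesis
        using height_embed_diff_same[of a c] c(2) by auto
    qed
  qed
qed

text \<open>If some \<open>\<rho>'\<close> in \<open>E\<close> is incomparable to
  \<open>\<rho>\<close>, take \<open>a\<close> in \<open>\<rho> - \<rho>'\<close> and
  \<open>c\<close> in \<open>\<rho>' - \<rho>\<close>. Each member of \<open>E \<union> C\<close>
  through \<open>a\<close> contains \<open>\<rho>'\<close> and hence \<open>c\<close>, so
  \<open>a\<close> is not higher than \<open>c\<close> and the gap of \<open>\<rho>\<close>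
  vanishes, like its coefficient.\<close>

lemma gap_embed:
  assumes \<rho>: "\<rho> \<in> Q"
  shows "gap (height (embed y)) \<rho> = coeff y \<rho>"
proof (cases "\<forall>\<rho>'\<in>E. \<rho> \<subseteq> \<rho>' \<or> \<rho>' \<subseteq> \<rho>")
  case True
  then show ?thesis
    using gap_embed_comparable[OF \<rho>] by blast
next
  case False
  then obtain \<rho>' where \<rho>': "\<rho>' \<in> E" "\<not> \<rho> \<subseteq> \<rho>'" "\<not> \<rho>' \<subseteq> \<rho>"
    by blast
  then obtain a c where ac: "a \<in> \<rho>" "a \<notin> \<rho>'" "c \<in> \<rho>'" "c \<notin> \<rho>"
    by blast
  have "\<rho> \<notin> E"
    using E_total \<rho>' by blast
  have "cover y a \<le> cover y c"
    unfolding cover_on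
  proof (intro sum_mono mult_right_mono coeff_nonneg)
    fix \<rho>'' assume "\<rho>'' \<in> E"
    then show "of_bool (a \<in> \<rho>'') \<le> (of_bool (c \<in> \<rho>'') :: real)"
      using E_total[OF \<rho>'(1), of \<rho>''] ac by auto
  qed
  moreover have "lvl a \<subseteq> lvl c"
    using Q_total[OF E_Q[OF \<rho>'(1)]] ac unfolding lvl_def by blast
  ultimately have "height (embed y) a \<le> height (embed y) c"
  proof (cases "lvl a = lvl c")
    case True
    then show ?thesis
      using height_embed_diff_same[OF True] \<open>cover y a \<le> cover y c\<close> by simp
  next
    case False
    then have "lvl a \<subset> lvl c"
      using \<open>lvl a \<subseteq> lvl c\<close> by blast
    then show ?thesis
      using height_embed_diff_less[of a c] by simp
  qed
  then have "\<not> 0 < gap (height (embed y)) \<rho>"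
    using ac gap_height_pos_iff[OF m_Union_face[OF E] embed_closed_simplex \<rho>] by fastforce
  then show ?thesis
    using gap_nonneg[of "height (embed y)" \<rho>] coeff_outside[OF \<open>\<rho> \<notin> E\<close>] by simp
qed

lemma retr_embed: "retr (embed y) = y"
proof -
  have weight: "weight (embed y) \<rho> = y \<rho>" for \<rho>
  proof (cases "\<rho> \<in> Q")
    case True
    then show ?thesis
      using gap_embed[OF True] card_m_coeff[OF True] by (simp add: weight_def mult.commute)
  next
    case False
    then have "y \<rho> = 0"
      using closed_simplex_zero[OF y] E_Q by blast
    then show ?thesis
      using False by (simp add: weight_def)
  qed
  have "(\<Sum>\<rho> | y \<rho> \<noteq> 0. y \<rho>) = 1"
    using closed_simplex_sum[OF closed_simplex_support(1)[OF y]] .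
  then show ?thesis
    by (simp add: retr_def weight fun_eq_iff)
qed

end

lemma continuous_map_embed: "continuous_map (realization L) (realization (link \<Sigma> S)) embed"
proof (rule continuous_map_realizationI)
  fix E assume E: "E \<in> L"
  have "embed ` closed_simplex E \<subseteq> (\<Union>\<tau>\<in>{\<Union>(m ` E)}. closed_simplex \<tau>)"
    using embed_closed_simplex[OF E] by (simp add: image_subset_iff)
  then show "\<exists>F. finite F \<and> F \<subseteq> link \<Sigma> S \<and> embed ` closed_simplex E \<subseteq> (\<Union>\<tau>\<in>F. closed_simplex \<tau>)"
    using m_Union_face[OF E] by (intro exI[of _ "{\<Union>(m ` E)}"]) simp
  fix v
  have eval: "continuous_on (closed_simplex E) (\<lambda>y::'a set \<Rightarrow> real. y \<rho> * c)" for \<rho> and c :: real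
    by (intro continuous_on_mult_right
        continuous_on_subset[OF continuous_on_product_coordinates subset_UNIV])
  have "continuous_on (closed_simplex E)
      (\<lambda>y. \<Sum>\<rho>\<in>E. y \<rho> * (of_bool (v \<in> m \<rho>) / real (card (m \<rho>))))"
    by (intro continuous_on_sum eval)
  moreover have "embed y v = (\<Sum>\<rho>\<in>E. y \<rho> * (of_bool (v \<in> m \<rho>) / real (card (m \<rho>))))"
    if "y \<in> closed_simplex E" for y
    unfolding embed_on[OF E that] coeff_def by (intro sum.cong refl) simp
  ultimately show "continuous_on (closed_simplex E) (\<lambda>y. embed y v)"
    by (simp cong: continuous_on_cong)
qed

lemma t_connected_L:
  assumes "t_connected t (link \<Sigma> S)"
  shows "t_connected t L"
proof -
  have "retr (embed y) = y" if "y \<in> topspace (realization L)" for y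
    using that unfolding topspace_realization by (elim UN_E) (rule retr_embed)
  then show ?thesis
    using t_connected_space_retract[OF _ continuous_map_embed continuous_map_retr] assms
    unfolding t_connected_def by blast
qed

end

theorem (in orbit_transversal) homotopy_Cohen_Macaulay_faces:
  assumes CM: "homotopy_Cohen_Macaulay \<Sigma>"
  shows "homotopy_Cohen_Macaulay (order_complex (D - {{}}) (\<subseteq>))"
proof -
  have fd: "finite_dimensional \<Sigma>"
    using CM by (simp add: homotopy_Cohen_Macaulay_def)
  have chain: "transversal_chain \<Sigma> rep E" if "E \<in> order_complex (D - {{}}) (\<subseteq>)" for E
    using that by unfold_locales
  have "finite_dimensional (order_complex (D - {{}}) (\<subseteq>))"
  proof -
    obtain n where n: "\<And>\<sigma>. \<sigma> \<in> \<Sigma> \<Longrightarrow> face_dim \<sigma> \<le> n"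
      using fd by (auto simp: finite_dimensional_def)
    have "face_dim E \<le> n" if E: "E \<in> order_complex (D - {{}}) (\<subseteq>)" for E
    proof -
      interpret transversal_chain \<Sigma> rep E
        by (rule chain[OF E])
      have "card E \<le> card U"
        unfolding U_def using finite_C C_chain C_D C_nonempty D_finite
        by (intro card_chain_le_card_Union) auto
      then show ?thesis
        using n[OF D_face[OF U_D]] by (simp add: face_dim_def)
    qed
    then show ?thesis
      by (auto simp: finite_dimensional_def)
  qed
  moreover have "t_connected (complex_dim (link (order_complex (D - {{}}) (\<subseteq>)) E) - 1)
      (link (order_complex (D - {{}}) (\<subseteq>)) E)" if E: "E \<in> order_complex (D - {{}}) (\<subseteq>)" for E
  proof -
    interpret transversal_chain \<Sigma> rep E
      by (rule chain[OF E])
    have "t_connected (complex_dim (link \<Sigma> S) - 1) L"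
      using CM D_face[OF S_D] by (intro t_connected_L) (simp add: homotopy_Cohen_Macaulay_def)
    then have "t_connected (complex_dim L - 1) L"
      using complex_dim_link_le[OF fd] t_connected_space_mono unfolding t_connected_def by force
    then show ?thesis
      by (simp add: L_def)
  qed
  ultimately show ?thesis
    by (simp add: homotopy_Cohen_Macaulay_def)
qed

section \<open>Decoupled actions\<close>

lemma order_complex_image:
  assumes leq: "\<And>a b. a \<in> P \<Longrightarrow> b \<in> P \<Longrightarrow> leq' (f a) (f b) \<longleftrightarrow> leq a b"
  shows "order_complex (f ` P) leq' = (`) f ` order_complex P leq"
proof -
  have chain: "Complete_Partial_Order.chain leq' (f ` E) \<longleftrightarrow> Complete_Partial_Order.chain leq E"
    if "E \<subseteq> P" for E
  proof -
    have "leq' (f a) (f b) \<longleftrightarrow> leq a b" if "a \<in> E" "b \<in> E" for a b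
      using leq that \<open>E \<subseteq> P\<close> by blast
    then show ?thesis
      unfolding chain_def by simp
  qed
  show ?thesis
  proof (intro equalityI subsetI)
    fix E' assume E': "E' \<in> order_complex (f ` P) leq'"
    then obtain E where E: "E \<subseteq> P" "finite E" "E' = f ` E"
      using finite_subset_image[of E' f P] by (auto simp: order_complex_def)
    then have "E \<in> order_complex P leq"
      using E' chain[OF E(1)] by (simp add: order_complex_def)
    then show "E' \<in> (`) f ` order_complex P leq"
      using E(3) by blast
  next
    fix E' assume "E' \<in> (`) f ` order_complex P leq"
    then obtain E where "E \<in> order_complex P leq" "E' = f ` E"
      by (rule imageE)
    then show "E' \<in> order_complex (f ` P) leq'"
      using chain[of E] by (auto simp: order_complex_def)
  qed
qed

locale decoupled_complex = comm_group H for H (structure) +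
  fixes V :: "'v set" and \<Sigma> :: "'v set set" and \<phi> and Hs :: "int \<Rightarrow> 'a set"
  assumes complex: "abstract_simplicial_complex V \<Sigma>"
    and fin_dim: "finite_dimensional \<Sigma>"
    and pure: "pure_complex \<Sigma>"
    and act: "complex_action H V \<Sigma> \<phi>"
    and transl: "translative H \<Sigma> \<phi>"
    and direct_sum: "internal_direct_sum H {0..complex_dim \<Sigma>} Hs"
    and nontrivial: "i \<in> {0..complex_dim \<Sigma>} \<Longrightarrow> Hs i \<noteq> {\<one>}"
    and stabilizers: "M \<in> maximal_faces \<Sigma> \<Longrightarrow> \<exists>x. M = x ` {0..complex_dim \<Sigma>} \<and>
      (\<forall>i\<in>{0..complex_dim \<Sigma>}. Hs i = stabilizer H (face_action \<Sigma> \<phi>) (M - {x i}))"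
begin

abbreviation "I \<equiv> {0..complex_dim \<Sigma>}"

sublocale action: group_action H V \<phi>
  using act by (simp add: complex_action_def)

lemma face_subset: "\<sigma> \<in> \<Sigma> \<Longrightarrow> \<tau> \<subseteq> \<sigma> \<Longrightarrow> \<tau> \<in> \<Sigma>"
  and face_finite: "\<sigma> \<in> \<Sigma> \<Longrightarrow> finite \<sigma>"
  and face_vertices: "\<sigma> \<in> \<Sigma> \<Longrightarrow> \<sigma> \<subseteq> V"
  and empty_face: "{} \<in> \<Sigma>"
  using complex by (auto simp: abstract_simplicial_complex_def)

lemma Union_faces: "\<Union>\<Sigma> = V"
  using complex by (auto simp: abstract_simplicial_complex_def)

lemma act_face: "h \<in> carrier H \<Longrightarrow> \<sigma> \<in> \<Sigma> \<Longrightarrow> \<phi> h ` \<sigma> \<in> \<Sigma>"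
  using act by (simp add: complex_action_def)

text \<open>\<open>\<sigma>\<close> is an upper bound of \<open>{v}\<close> and its translate, so
  translativity applies to single vertices.\<close>

lemma act_fixes:
  assumes "h \<in> carrier H" "\<sigma> \<in> \<Sigma>" "v \<in> \<sigma>" "\<phi> h v \<in> \<sigma>"
  shows "\<phi> h v = v"
proof -
  have "{v} \<in> \<Sigma>"
    by (rule face_subset[OF assms(2)]) (simp add: assms(3))
  have eq: "face_action \<Sigma> \<phi> h {v} = {\<phi> h v}"
    using \<open>{v} \<in> \<Sigma>\<close> by (simp add: face_action_def)
  have "\<exists>\<tau>\<in>\<Sigma>. {v} \<subseteq> \<tau> \<and> face_action \<Sigma> \<phi> h {v} \<subseteq> \<tau>"
    unfolding eq using assms by (intro bexI[of _ \<sigma>]) auto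
  then have "{\<phi> h v} = {v}"
    using transl \<open>{v} \<in> \<Sigma>\<close> assms(1) unfolding translative_def translative_on_def eq[symmetric]
    by simp
  then show ?thesis
    by simp
qed

lemma exists_maximal_face:
  assumes \<sigma>: "\<sigma> \<in> \<Sigma>"
  obtains M where "M \<in> maximal_faces \<Sigma>" "\<sigma> \<subseteq> M"
proof -
  obtain n where n: "\<And>\<sigma>. \<sigma> \<in> \<Sigma> \<Longrightarrow> face_dim \<sigma> \<le> n"
    using fin_dim by (auto simp: finite_dimensional_def)
  \<comment> \<open>\<open>face_dim \<tau> \<le> n\<close> means at most \<open>n + 1\<close>
    vertices, hence the strict bound \<open>n + 2\<close>.\<close>
  have "\<forall>\<tau>. \<tau> \<in> \<Sigma> \<and> \<sigma> \<subseteq> \<tau> \<longrightarrow> card \<tau> < nat (n + 2)"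
    using n by (fastforce simp: face_dim_def)
  then have "\<exists>M. (M \<in> \<Sigma> \<and> \<sigma> \<subseteq> M) \<and> (\<forall>\<tau>. \<tau> \<in> \<Sigma> \<and> \<sigma> \<subseteq> \<tau> \<longrightarrow> card \<tau> \<le> card M)"
    using ex_has_greatest_nat[of "\<lambda>M. M \<in> \<Sigma> \<and> \<sigma> \<subseteq> M" \<sigma> card "nat (n + 2)"] \<sigma> by simp
  then obtain M where M: "M \<in> \<Sigma>" "\<sigma> \<subseteq> M"
    and max: "\<And>\<tau>. \<tau> \<in> \<Sigma> \<Longrightarrow> \<sigma> \<subseteq> \<tau> \<Longrightarrow> card \<tau> \<le> card M"
    by blast
  have "\<tau> = M" if "\<tau> \<in> \<Sigma>" "M \<subseteq> \<tau>" for \<tau>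
    using card_seteq[OF face_finite[OF that(1)] that(2) max[OF that(1)]] M(2) that(2) by auto
  then have "M \<in> maximal_faces \<Sigma>"
    using M(1) by (simp add: maximal_faces_def)
  then show ?thesis
    using M(2) that by blast
qed

text \<open>A face of largest dimension lies in a maximal one, which then has dimension
  \<open>complex_dim \<Sigma>\<close>; purity carries this over to \<open>M\<close>.\<close>

lemma face_dim_maximal:
  assumes M: "M \<in> maximal_faces \<Sigma>"
  shows "face_dim M = complex_dim \<Sigma>"
proof -
  obtain n where "\<And>\<sigma>. \<sigma> \<in> \<Sigma> \<Longrightarrow> face_dim \<sigma> \<le> n"
    using fin_dim by (auto simp: finite_dimensional_def)
  then have "face_dim ` \<Sigma> \<subseteq> {-1..n}"
    by (auto simp: face_dim_def)
  then have fin: "finite (face_dim ` \<Sigma>)"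
    by (rule finite_subset) simp
  then have "Max (face_dim ` \<Sigma>) \<in> face_dim ` \<Sigma>"
    using empty_face by (intro Max_in) auto
  then obtain \<sigma> where "Max (face_dim ` \<Sigma>) = face_dim \<sigma>" "\<sigma> \<in> \<Sigma>"
    by (rule imageE)
  then have \<sigma>: "\<sigma> \<in> \<Sigma>" "face_dim \<sigma> = complex_dim \<Sigma>"
    by (simp_all add: complex_dim_def)
  obtain M' where M': "M' \<in> maximal_faces \<Sigma>" "\<sigma> \<subseteq> M'"
    using exists_maximal_face[OF \<sigma>(1)] by blast
  then have "M' \<in> \<Sigma>"
    by (simp add: maximal_faces_def)
  then have "face_dim M' \<le> complex_dim \<Sigma>"
    using fin by (simp add: complex_dim_def)
  moreover have "face_dim \<sigma> \<le> face_dim M'"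
    using card_mono[OF face_finite[OF \<open>M' \<in> \<Sigma>\<close>] M'(2)] by (simp add: face_dim_def)
  moreover have "face_dim M = face_dim M'"
    using pure M M'(1) unfolding pure_complex_def by blast
  ultimately show ?thesis
    using \<sigma>(2) by simp
qed

definition labelling :: "'v set \<Rightarrow> (int \<Rightarrow> 'v) \<Rightarrow> bool" where
  "labelling M x \<longleftrightarrow> M \<in> \<Sigma> \<and> M = x ` I \<and> inj_on x I \<and>
     (\<forall>i\<in>I. Hs i = stabilizer H (face_action \<Sigma> \<phi>) (M - {x i}))"

lemma exists_labelling:
  assumes \<sigma>: "\<sigma> \<in> \<Sigma>"
  obtains M x where "labelling M x" "\<sigma> \<subseteq> M"
proof -
  obtain M where M: "M \<in> maximal_faces \<Sigma>" "\<sigma> \<subseteq> M"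
    using exists_maximal_face[OF \<sigma>] .
  obtain x where x: "M = x ` I" "\<forall>i\<in>I. Hs i = stabilizer H (face_action \<Sigma> \<phi>) (M - {x i})"
    using stabilizers[OF M(1)] by blast
  \<comment> \<open>A maximal face has as many vertices as \<open>I\<close> has indices, so the
    enumeration has no repetitions.\<close>
  have "card (x ` I) = card I"
    using face_dim_maximal[OF M(1)] x(1) by (simp add: face_dim_def)
  then have "inj_on x I"
    by (intro eq_card_imp_inj_on) simp_all
  then have "labelling M x"
    using M(1) x by (simp add: labelling_def maximal_faces_def)
  then show ?thesis
    using M(2) that by blast
qed

section \<open>The summands and their action on a labelled face\<close>

lemma Hs_subgroup: "i \<in> I \<Longrightarrow> subgroup (Hs i) H"
  using direct_sum by (simp add: internal_direct_sum_def)

lemma Hs_carrier: "i \<in> I \<Longrightarrow> h \<in> Hs i \<Longrightarrow> h \<in> carrier H"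
  using subgroup.subset[OF Hs_subgroup] by blast

lemma sum_group_carrier: "carrier (sum_group I (\<lambda>i. H\<lparr>carrier := Hs i\<rparr>)) = (\<Pi>\<^sub>E i\<in>I. Hs i)"
proof -
  have "group (H\<lparr>carrier := Hs i\<rparr>)" if "i \<in> I" for i
    by (rule subgroup.subgroup_is_group[OF Hs_subgroup[OF that] is_group])
  then have "carrier (sum_group I (\<lambda>i. H\<lparr>carrier := Hs i\<rparr>))
      = {c \<in> \<Pi>\<^sub>E i\<in>I. Hs i. finite {i \<in> I. c i \<noteq> \<one>}}"
    by (subst carrier_sum_group) simp_all
  moreover have "finite {i \<in> I. c i \<noteq> \<one>}" for c
    by (rule finite_subset[of _ I]) auto
  ultimately show ?thesis
    by (simp only: simp_thms Collect_mem_eq)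
qed

lemma bij_betw_finprod: "bij_betw (\<lambda>c. finprod H c I) (\<Pi>\<^sub>E i\<in>I. Hs i) (carrier H)"
  using direct_sum by (simp add: internal_direct_sum_def iso_def sum_group_carrier)

lemma decompose:
  assumes "h \<in> carrier H"
  shows "\<exists>c. (\<forall>i\<in>I. c i \<in> Hs i) \<and> finprod H c I = h"
proof -
  have "h \<in> (\<lambda>c. finprod H c I) ` (\<Pi>\<^sub>E i\<in>I. Hs i)"
    using bij_betw_imp_surj_on[OF bij_betw_finprod] assms by simp
  then obtain c where c: "h = finprod H c I" "c \<in> (\<Pi>\<^sub>E i\<in>I. Hs i)"
    by (rule imageE)
  then have "\<forall>i\<in>I. c i \<in> Hs i"
    by (intro ballI) (rule PiE_mem)
  then show ?thesis
    using c(1) by blast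
qed

text \<open>The two families with \<open>h\<close> in position \<open>i\<close>, respectively
  \<open>j\<close>, and the neutral element elsewhere have the same product, so they coincide by
  uniqueness of the decomposition; then compare the entries at \<open>i\<close>.\<close>

lemma Hs_disjoint:
  assumes i: "i \<in> I" and j: "j \<in> I" and "i \<noteq> j" and h: "h \<in> Hs i" "h \<in> Hs j"
  shows "h = \<one>"
proof -
  define c where "c k = (\<lambda>l\<in>I. if l = k then h else \<one>)" for k
  have c_PiE: "c k \<in> (\<Pi>\<^sub>E i\<in>I. Hs i)" if "h \<in> Hs k" for k
    using that subgroup.one_closed[OF Hs_subgroup] by (auto simp: c_def)
  have "finprod H (c k) I = h" if k: "k \<in> I" for k
  proof -
    have "finprod H (c k) I = (\<Otimes>l\<in>I. if l = k then h else \<one>)"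
      using h Hs_carrier[OF i] by (intro finprod_cong) (auto simp: c_def simp_implies_def)
    also have "\<dots> = h"
      using k h Hs_carrier[OF i] by (intro finprod_singleton_swap[of k I "\<lambda>_. h"]) auto
    finally show ?thesis .
  qed
  then have "c i = c j"
    using bij_betw_finprod c_PiE h i j unfolding bij_betw_def inj_on_def by metis
  then have "c i i = c j i"
    by simp
  then show ?thesis
    using i \<open>i \<noteq> j\<close> by (simp add: c_def)
qed

text \<open>\<open>h\<close> stabilizes \<open>M - {x i}\<close> as a set, so it keeps
  \<open>x j\<close> inside the face \<open>M\<close>, and translativity turns this into a fixed
  vertex.\<close>

lemma Hs_fixes:
  assumes x: "labelling M x" and i: "i \<in> I" and j: "j \<in> I" and "i \<noteq> j" and h: "h \<in> Hs i"
  shows "\<phi> h (x j) = x j"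
proof -
  have M: "M \<in> \<Sigma>" "M - {x i} \<in> \<Sigma>"
    using x face_subset[of M "M - {x i}"] by (auto simp: labelling_def)
  have "h \<in> stabilizer H (face_action \<Sigma> \<phi>) (M - {x i})"
    using x i h by (simp add: labelling_def)
  then have "\<phi> h ` (M - {x i}) = M - {x i}"
    using M(2) by (simp add: stabilizer_def face_action_def)
  moreover have xj: "x j \<in> M - {x i}"
    using x i j \<open>i \<noteq> j\<close> by (auto simp: labelling_def inj_on_def)
  ultimately have "\<phi> h (x j) \<in> M"
    by blast
  then show ?thesis
    using act_fixes[OF Hs_carrier[OF i h] M(1)] xj by blast
qed

text \<open>All factors other than the one of colour \<open>j\<close> fix \<open>x j\<close>; by
  commutativity that factor can be applied last.\<close>

lemma act_finprod:
  assumes x: "labelling M x" and j: "j \<in> I" and c: "\<And>i. i \<in> I \<Longrightarrow> c i \<in> Hs i"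
  shows "\<phi> (finprod H c I) (x j) = \<phi> (c j) (x j)"
proof -
  have "x j \<in> M" "M \<in> \<Sigma>"
    using x j unfolding labelling_def by blast+
  then have xj: "x j \<in> V"
    using face_vertices by blast
  have c_carrier: "c i \<in> carrier H" if "i \<in> I" for i
    using c Hs_carrier that by blast
  have "finite F \<Longrightarrow> F \<subseteq> I - {j} \<Longrightarrow> \<phi> (finprod H c F) (x j) = x j" for F
  proof (induction F rule: finite_induct)
    case empty
    then show ?case
      using action.id_eq_one xj by (metis finprod_empty restrict_apply')
  next
    case (insert i F)
    then have "i \<in> I" "i \<noteq> j" "F \<subseteq> I"
      by auto
    then have F: "c \<in> F \<rightarrow> carrier H" "c i \<in> carrier H"
      using c_carrier by auto
    then have "\<phi> (finprod H c (insert i F)) (x j) = \<phi> (c i) (\<phi> (finprod H c F) (x j))"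
      using insert.hyps xj by (simp add: action.composition_rule)
    then show ?case
      using insert Hs_fixes[OF x \<open>i \<in> I\<close> j \<open>i \<noteq> j\<close> c[OF \<open>i \<in> I\<close>]] by simp
  qed
  from this[of "I - {j}"] have rest: "\<phi> (finprod H c (I - {j})) (x j) = x j"
    by simp
  have "c \<in> (I - {j}) \<rightarrow> carrier H"
    using c_carrier by blast
  then have "\<phi> (finprod H c (insert j (I - {j}))) (x j) = \<phi> (c j) (\<phi> (finprod H c (I - {j})) (x j))"
    using c_carrier[OF j] xj by (subst finprod_insert) (simp_all add: action.composition_rule)
  then show ?thesis
    using rest j by (simp add: insert_absorb)
qed

text \<open>At \<open>v\<close> only the component of \<open>k v\<close> in the summand of the
  colour of \<open>v\<close> has an effect. These components, one per colour, multiply to a single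
  group element; for a colour missing in \<open>\<sigma>\<close> any element of the summand will
  do.\<close>

lemma act_independently:
  assumes \<sigma>: "\<sigma> \<in> \<Sigma>" and k: "\<And>v. v \<in> \<sigma> \<Longrightarrow> k v \<in> carrier H"
  shows "\<exists>h\<in>carrier H. \<forall>v\<in>\<sigma>. \<phi> h v = \<phi> (k v) v"
proof -
  obtain M x where x: "labelling M x" and \<sigma>M: "\<sigma> \<subseteq> M"
    using exists_labelling[OF \<sigma>] .
  have "\<exists>d. d \<in> Hs i \<and> (x i \<in> \<sigma> \<longrightarrow> \<phi> d (x i) = \<phi> (k (x i)) (x i))" if i: "i \<in> I" for i
  proof (cases "x i \<in> \<sigma>")
    case True
    obtain c where c: "\<forall>i\<in>I. c i \<in> Hs i" "finprod H c I = k (x i)"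
      using decompose[OF k[OF True]] by (elim exE conjE)
    then have "\<phi> (c i) (x i) = \<phi> (k (x i)) (x i)"
      using act_finprod[OF x i, of c] by simp
    then show ?thesis
      using c(1) i by blast
  next
    case False
    then show ?thesis
      using subgroup.one_closed[OF Hs_subgroup[OF i]] by blast
  qed
  then obtain d where d: "\<And>i. i \<in> I \<Longrightarrow> d i \<in> Hs i"
    "\<And>i. i \<in> I \<Longrightarrow> x i \<in> \<sigma> \<Longrightarrow> \<phi> (d i) (x i) = \<phi> (k (x i)) (x i)"
    by metis
  have "d \<in> I \<rightarrow> carrier H"
    using d(1) Hs_carrier by blast
  moreover have "\<phi> (finprod H d I) v = \<phi> (k v) v" if v: "v \<in> \<sigma>" for v
  proof -
    obtain j where "j \<in> I" "v = x j"
      using v \<sigma>M x by (auto simp: labelling_def)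
    then show ?thesis
      using act_finprod[OF x, of j d] d v by simp
  qed
  ultimately show ?thesis
    by (intro bexI[of _ "finprod H d I"] ballI finprod_closed)
qed

text \<open>The choice sees \<open>v\<close> only through its orbit, so all vertices of an orbit
  share it.\<close>

definition rep :: "'v \<Rightarrow> 'v" where
  "rep v = (if v \<in> V then SOME w. w \<in> orbit H \<phi> v else v)"

lemma rep_in_orbit: "v \<in> V \<Longrightarrow> rep v \<in> orbit H \<phi> v"
  unfolding rep_def using someI[of "\<lambda>w. w \<in> orbit H \<phi> v" v] action.orbit_refl by simp

lemma orbit_in_V: "v \<in> V \<Longrightarrow> w \<in> orbit H \<phi> v \<Longrightarrow> w \<in> V"
  using action.element_image by (auto simp: orbit_def)

lemma orbit_eq:
  assumes v: "v \<in> V" and w: "w \<in> orbit H \<phi> v"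
  shows "orbit H \<phi> w = orbit H \<phi> v"
proof -
  have "w \<in> V" "v \<in> orbit H \<phi> w"
    using orbit_in_V action.orbit_sym v w by blast+
  then show ?thesis
    using action.orbit_trans v w orbit_in_V by blast
qed

lemma rep_in_V: "v \<in> V \<Longrightarrow> rep v \<in> V"
  using rep_in_orbit orbit_in_V by blast

lemma rep_eq_iff:
  assumes "v \<in> V" "w \<in> V"
  shows "rep v = rep w \<longleftrightarrow> w \<in> orbit H \<phi> v"
proof
  assume "rep v = rep w"
  then have "orbit H \<phi> v = orbit H \<phi> w"
    using orbit_eq[OF assms(1) rep_in_orbit[OF assms(1)]] orbit_eq[OF assms(2) rep_in_orbit[OF assms(2)]]
    by simp
  then show "w \<in> orbit H \<phi> v"
    using action.orbit_refl[OF assms(2)] by simp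
next
  assume "w \<in> orbit H \<phi> v"
  then have "orbit H \<phi> w = orbit H \<phi> v"
    using orbit_eq[OF assms(1)] by blast
  then show "rep v = rep w"
    using assms by (simp add: rep_def)
qed

text \<open>Each vertex is moved by a group element of its own, and \<open>act_independently\<close>
  merges these into one. It yields the assumption \<open>swap\<close>, and with \<open>rep\<close>
  for \<open>g\<close> it moves a face onto its representatives.\<close>

lemma act_same_orbit:
  assumes \<sigma>: "\<sigma> \<in> \<Sigma>" and g: "\<And>v. v \<in> \<sigma> \<Longrightarrow> g v \<in> V \<and> rep (g v) = rep v"
  obtains h where "h \<in> carrier H" "g ` \<sigma> = \<phi> h ` \<sigma>"
proof -
  have "\<exists>k\<in>carrier H. \<phi> k v = g v" if "v \<in> \<sigma>" for v
  proof -
    have "v \<in> V"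
      using that face_vertices[OF \<sigma>] by blast
    then have "g v \<in> orbit H \<phi> v"
      using g[OF that] rep_eq_iff[of v "g v"] by simp
    then show ?thesis
      by (auto simp: orbit_def)
  qed
  then obtain k where k: "\<And>v. v \<in> \<sigma> \<Longrightarrow> k v \<in> carrier H" "\<And>v. v \<in> \<sigma> \<Longrightarrow> \<phi> (k v) v = g v"
    by metis
  obtain h where h: "h \<in> carrier H" "\<forall>v\<in>\<sigma>. \<phi> h v = \<phi> (k v) v"
    using bexE[OF act_independently[OF \<sigma> k(1)]] .
  then have "g ` \<sigma> = \<phi> h ` \<sigma>"
    using k(2) by (intro image_cong) simp_all
  then show ?thesis
    using h(1) that by blast
qed

lemma rep_act:
  assumes "h \<in> carrier H" "v \<in> V"
  shows "rep (\<phi> h v) = rep v"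
proof -
  have "\<phi> h v \<in> orbit H \<phi> v"
    using assms(1) unfolding orbit_def by blast
  then show ?thesis
    using rep_eq_iff[OF assms(2) orbit_in_V[OF assms(2)]] by simp
qed

text \<open>A nontrivial \<open>h\<close> in the summand of \<open>v\<close> fixes all other
  vertices of \<open>M\<close>. If it also fixed \<open>v\<close>, it would stabilize the facet
  opposite to \<open>w\<close> and so lie in the summand of \<open>w\<close> as well, which meets
  that of \<open>v\<close> trivially.\<close>

lemma exists_mate:
  assumes \<sigma>: "\<sigma> \<in> \<Sigma>" and v: "v \<in> \<sigma>" "w \<in> \<sigma>" "v \<noteq> w"
  shows "\<exists>v'\<in>V. v' \<noteq> v \<and> rep v' = rep v"
proof -
  obtain M x where x: "labelling M x" and \<sigma>M: "\<sigma> \<subseteq> M"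
    using exists_labelling[OF \<sigma>] .
  have "v \<in> x ` I" "w \<in> x ` I"
    using x \<sigma>M v by (auto simp: labelling_def)
  then obtain i j where j: "j \<in> I" "v = x j" and i: "i \<in> I" "w = x i"
    by blast
  then have "i \<noteq> j"
    using v(3) by auto
  obtain h where h: "h \<in> Hs j" "h \<noteq> \<one>"
    using nontrivial[OF j(1)] subgroup.one_closed[OF Hs_subgroup[OF j(1)]] by blast
  have hH: "h \<in> carrier H"
    using Hs_carrier j(1) h(1) by blast
  have vV: "v \<in> V"
    using v(1) face_vertices[OF \<sigma>] by blast
  have "\<phi> h v \<noteq> v"
  proof
    assume fix_v: "\<phi> h v = v"
    have "\<phi> h u = u" if u: "u \<in> M" for u
    proof -
      obtain l where l: "l \<in> I" "u = x l"
        using x u by (auto simp: labelling_def)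
      then show ?thesis
        using Hs_fixes[OF x j(1) l(1) _ h(1)] fix_v j(2) by (cases "l = j") auto
    qed
    then have "\<phi> h ` (M - {x i}) = M - {x i}"
      by simp
    moreover have "M - {x i} \<in> \<Sigma>"
      using x face_subset[of M "M - {x i}"] by (auto simp: labelling_def)
    ultimately have "h \<in> stabilizer H (face_action \<Sigma> \<phi>) (M - {x i})"
      using hH by (simp add: stabilizer_def face_action_def)
    then have "h \<in> Hs i"
      using x i(1) by (simp add: labelling_def)
    then show False
      using Hs_disjoint[OF i(1) j(1) \<open>i \<noteq> j\<close> _ h(1)] h(2) by blast
  qed
  then show ?thesis
    using rep_act[OF hH vV] action.element_image[OF hH vV] by blast
qed

sublocale transversal: orbit_transversal \<Sigma> rep
proof
  show "{} \<in> \<Sigma>"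
    by (rule empty_face)
  show "finite \<sigma>" if "\<sigma> \<in> \<Sigma>" for \<sigma>
    using that by (rule face_finite)
  show "\<tau> \<in> \<Sigma>" if "\<sigma> \<in> \<Sigma>" "\<tau> \<subseteq> \<sigma>" for \<sigma> \<tau>
    using that by (rule face_subset)
  show "rep (rep v) = rep v" for v
  proof (cases "v \<in> V")
    case True
    then show ?thesis
      using rep_eq_iff[of v "rep v"] rep_in_V rep_in_orbit by simp
  qed (simp add: rep_def)
  show "rep v \<in> \<Union>\<Sigma>" if "v \<in> \<Union>\<Sigma>" for v
    using that unfolding Union_faces by (rule rep_in_V)
  show "inj_on rep \<sigma>" if \<sigma>: "\<sigma> \<in> \<Sigma>" for \<sigma>
  proof (rule inj_onI)
    fix v w assume v: "v \<in> \<sigma>" "w \<in> \<sigma>" "rep v = rep w"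
    then have "w \<in> orbit H \<phi> v"
      using face_vertices[OF \<sigma>] rep_eq_iff[of v w] by blast
    then obtain h where h: "h \<in> carrier H" "w = \<phi> h v"
      by (auto simp: orbit_def)
    then show "v = w"
      using act_fixes[OF h(1) \<sigma> v(1)] v(2) by simp
  qed
  show "g ` \<sigma> \<in> \<Sigma>" if \<sigma>: "\<sigma> \<in> \<Sigma>" and g: "\<And>v. v \<in> \<sigma> \<Longrightarrow> g v \<in> \<Union>\<Sigma> \<and> rep (g v) = rep v" for \<sigma> g
  proof -
    obtain h where "h \<in> carrier H" "g ` \<sigma> = \<phi> h ` \<sigma>"
      using act_same_orbit[OF \<sigma> g[unfolded Union_faces]] .
    then show ?thesis
      using act_face \<sigma> by simp
  qed
  show "\<exists>v'\<in>\<Union>\<Sigma>. v' \<noteq> v \<and> rep v' = rep v"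
    if "\<sigma> \<in> \<Sigma>" "v \<in> \<sigma>" "w \<in> \<sigma>" "v \<noteq> w" for \<sigma> v w
    unfolding Union_faces using that by (rule exists_mate)
qed

section \<open>The orbit poset as a poset of faces\<close>

abbreviation face_orbit :: "'v set \<Rightarrow> 'v set set" where
  "face_orbit \<equiv> orbit H (face_action \<Sigma> \<phi>)"

lemma face_orbit: "\<sigma> \<in> \<Sigma> \<Longrightarrow> face_orbit \<sigma> = {\<phi> h ` \<sigma> | h. h \<in> carrier H}"
  by (simp add: orbit_def face_action_def)

lemma face_orbit_act_subset:
  assumes \<sigma>: "\<sigma> \<in> \<Sigma>" and h: "h \<in> carrier H"
  shows "face_orbit (\<phi> h ` \<sigma>) \<subseteq> face_orbit \<sigma>"
proof
  fix \<tau> assume "\<tau> \<in> face_orbit (\<phi> h ` \<sigma>)"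
  then obtain k where k: "k \<in> carrier H" "\<tau> = \<phi> k ` \<phi> h ` \<sigma>"
    by (auto simp: face_orbit[OF act_face[OF h \<sigma>]])
  have "\<tau> = \<phi> (k \<otimes> h) ` \<sigma>"
    unfolding k(2) image_image
    using face_vertices[OF \<sigma>] k(1) h by (intro image_cong) (auto simp: action.composition_rule)
  then show "\<tau> \<in> face_orbit \<sigma>"
    using k(1) h by (auto simp: face_orbit[OF \<sigma>])
qed

lemma face_orbit_act:
  assumes \<sigma>: "\<sigma> \<in> \<Sigma>" and h: "h \<in> carrier H"
  shows "face_orbit (\<phi> h ` \<sigma>) = face_orbit \<sigma>"
proof
  show "face_orbit (\<phi> h ` \<sigma>) \<subseteq> face_orbit \<sigma>"
    using assms by (rule face_orbit_act_subset)
  have "\<phi> (inv h) ` \<phi> h ` \<sigma> = \<sigma>"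
    using face_vertices[OF \<sigma>] action.orbit_sym_aux[OF h] by (force simp: image_image)
  then show "face_orbit \<sigma> \<subseteq> face_orbit (\<phi> h ` \<sigma>)"
    using face_orbit_act_subset[OF act_face[OF h \<sigma>], of "inv h"] h by simp
qed

lemma rep_image_act: "\<sigma> \<in> \<Sigma> \<Longrightarrow> h \<in> carrier H \<Longrightarrow> rep ` \<phi> h ` \<sigma> = rep ` \<sigma>"
  using face_vertices rep_act unfolding image_image by (intro image_cong) auto

text \<open>One group element moves all vertices of \<open>\<sigma>\<close> to their
  representatives, so every orbit of faces meets \<open>D\<close>.\<close>

lemma face_orbit_rep:
  assumes \<sigma>: "\<sigma> \<in> \<Sigma>"
  shows "face_orbit (rep ` \<sigma>) = face_orbit \<sigma>"
proof -
  have "rep v \<in> V \<and> rep (rep v) = rep v" if "v \<in> \<sigma>" for v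
    using that face_vertices[OF \<sigma>] rep_in_V transversal.rep_rep by blast
  then obtain h where "h \<in> carrier H" "rep ` \<sigma> = \<phi> h ` \<sigma>"
    by (rule act_same_orbit[OF \<sigma>])
  then show ?thesis
    using face_orbit_act[OF \<sigma>] by simp
qed

lemma self_in_face_orbit:
  assumes \<sigma>: "\<sigma> \<in> \<Sigma>"
  shows "\<sigma> \<in> face_orbit \<sigma>" "\<phi> \<one> ` \<sigma> = \<sigma>"
proof -
  show *: "\<phi> \<one> ` \<sigma> = \<sigma>"
    using face_vertices[OF \<sigma>] unfolding action.id_eq_one[symmetric] by (simp add: subset_iff)
  show "\<sigma> \<in> face_orbit \<sigma>"
    unfolding face_orbit[OF \<sigma>] using *[symmetric] by blast
qed

text \<open>The image under \<open>rep\<close> is an invariant of the orbit of a face, because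
  \<open>rep\<close> is constant on orbits of vertices. Faces in \<open>D\<close> are their own
  images, so no orbit meets \<open>D\<close> twice.\<close>

lemma rep_image_eq_if_face_orbit_eq:
  assumes \<sigma>: "\<sigma> \<in> \<Sigma>" and \<tau>: "\<tau> \<in> \<Sigma>" and eq: "face_orbit \<sigma> = face_orbit \<tau>"
  shows "rep ` \<sigma> = rep ` \<tau>"
proof -
  have "\<tau> \<in> face_orbit \<sigma>"
    using self_in_face_orbit(1)[OF \<tau>] eq by simp
  then obtain h where "h \<in> carrier H" "\<tau> = \<phi> h ` \<sigma>"
    by (auto simp: face_orbit[OF \<sigma>])
  then show ?thesis
    using rep_image_act[OF \<sigma>] by simp
qed

abbreviation "D \<equiv> transversal.D"

lemma rep_image_D_id: "\<rho> \<in> D \<Longrightarrow> rep ` \<rho> = \<rho>"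
  using transversal.D_rep by simp

lemma inj_on_face_orbit: "inj_on face_orbit D"
  using rep_image_eq_if_face_orbit_eq transversal.D_face rep_image_D_id by (intro inj_onI) metis

lemma empty_D: "{} \<in> D"
  by (simp add: transversal.D_def empty_face)

lemma reduced_face_orbits_eq: "reduced_face_orbits H \<Sigma> \<phi> = face_orbit ` (D - {{}})"
proof -
  have "orbits H \<Sigma> (face_action \<Sigma> \<phi>) = face_orbit ` D"
  proof (intro equalityI subsetI)
    fix A assume "A \<in> orbits H \<Sigma> (face_action \<Sigma> \<phi>)"
    then obtain \<sigma> where \<sigma>: "\<sigma> \<in> \<Sigma>" "A = face_orbit \<sigma>"
      by (auto simp: orbits_def)
    then have "A = face_orbit (rep ` \<sigma>)"
      using face_orbit_rep by simp
    then show "A \<in> face_orbit ` D"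
      using transversal.rep_image_D[OF \<sigma>(1)] by (rule image_eqI)
  next
    fix A assume "A \<in> face_orbit ` D"
    then show "A \<in> orbits H \<Sigma> (face_action \<Sigma> \<phi>)"
      using transversal.D_face by (auto simp: orbits_def)
  qed
  then show ?thesis
    using inj_on_image_set_diff[OF inj_on_face_orbit, of D "{{}}"] empty_D
    by (simp add: reduced_face_orbits_def)
qed

text \<open>Applying \<open>rep\<close> to an inclusion of a translate forgets the translation and
  returns the two members of \<open>D\<close>.\<close>

lemma face_orbit_le_iff:
  assumes \<rho>: "\<rho> \<in> D" "\<rho>' \<in> D"
  shows "face_orbit_le H \<Sigma> \<phi> (face_orbit \<rho>) (face_orbit \<rho>') \<longleftrightarrow> \<rho> \<subseteq> \<rho>'"
proof
  assume "face_orbit_le H \<Sigma> \<phi> (face_orbit \<rho>) (face_orbit \<rho>')"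
  then obtain \<sigma> \<tau> h where \<sigma>: "\<sigma> \<in> \<Sigma>" "\<tau> \<in> \<Sigma>" "face_orbit \<rho> = face_orbit \<sigma>"
    "face_orbit \<rho>' = face_orbit \<tau>" "h \<in> carrier H" "\<phi> h ` \<sigma> \<subseteq> \<tau>"
    by (auto simp: face_orbit_le_def orbit_le_def face_action_def)
  have "rep ` \<sigma> = \<rho>" "rep ` \<tau> = \<rho>'"
    using rep_image_eq_if_face_orbit_eq[OF transversal.D_face[OF \<rho>(1)] \<sigma>(1,3)]
      rep_image_eq_if_face_orbit_eq[OF transversal.D_face[OF \<rho>(2)] \<sigma>(2,4)]
      rep_image_D_id[OF \<rho>(1)] rep_image_D_id[OF \<rho>(2)] by auto
  moreover have "rep ` \<sigma> \<subseteq> rep ` \<tau>"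
    using image_mono[OF \<sigma>(6), of rep] rep_image_act[OF \<sigma>(1,5)] by simp
  ultimately show "\<rho> \<subseteq> \<rho>'"
    by simp
next
  assume "\<rho> \<subseteq> \<rho>'"
  moreover have "face_action \<Sigma> \<phi> \<one> \<rho> = \<rho>"
    using self_in_face_orbit(2) transversal.D_face[OF \<rho>(1)] by (simp add: face_action_def)
  ultimately show "face_orbit_le H \<Sigma> \<phi> (face_orbit \<rho>) (face_orbit \<rho>')"
    using transversal.D_face \<rho> one_closed unfolding face_orbit_le_def orbit_le_def by metis
qed

theorem homotopy_Cohen_Macaulay_face_orbits:
  assumes "homotopy_Cohen_Macaulay \<Sigma>"
  shows "poset_homotopy_Cohen_Macaulay (reduced_face_orbits H \<Sigma> \<phi>) (face_orbit_le H \<Sigma> \<phi>)"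
proof -
  let ?K = "order_complex (D - {{}}) (\<subseteq>)"
  have "order_complex (reduced_face_orbits H \<Sigma> \<phi>) (face_orbit_le H \<Sigma> \<phi>) = (`) face_orbit ` ?K"
    unfolding reduced_face_orbits_eq using face_orbit_le_iff by (intro order_complex_image) blast
  moreover have "homotopy_Cohen_Macaulay ((`) face_orbit ` ?K)"
  proof (rule homotopy_Cohen_Macaulay_image)
    show "inj_on face_orbit (\<Union>?K)"
      by (rule inj_on_subset[OF inj_on_face_orbit]) (auto simp: order_complex_def)
    show "homotopy_Cohen_Macaulay ?K"
      using assms by (rule transversal.homotopy_Cohen_Macaulay_faces)
  qed
  ultimately show ?thesis
    by (simp add: poset_homotopy_Cohen_Macaulay_def)
qed

end

theorem theorem3:
  fixes H :: "('g, 'm) monoid_scheme"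
    and V :: "'v set"
    and \<Sigma> :: "'v set set"
    and \<phi> :: "'g \<Rightarrow> 'v \<Rightarrow> 'v"
  assumes "comm_group H"
    and "abstract_simplicial_complex V \<Sigma>"
    and "finite_dimensional \<Sigma>"
    and "pure_complex \<Sigma>"
    and "complex_action H V \<Sigma> \<phi>"
    and "decoupled H \<Sigma> \<phi>"
    and "homotopy_Cohen_Macaulay \<Sigma>"
  shows "poset_homotopy_Cohen_Macaulay (reduced_face_orbits H \<Sigma> \<phi>) (face_orbit_le H \<Sigma> \<phi>)"
proof -
  obtain Hs where Hs: "internal_direct_sum H {0..complex_dim \<Sigma>} Hs"
    "\<forall>i\<in>{0..complex_dim \<Sigma>}. Hs i \<noteq> {\<one>\<^bsub>H\<^esub>}"
    "\<forall>M\<in>maximal_faces \<Sigma>. \<exists>x. M = x ` {0..complex_dim \<Sigma>} \<and>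
       (\<forall>i\<in>{0..complex_dim \<Sigma>}. Hs i = stabilizer H (face_action \<Sigma> \<phi>) (M - {x i}))"
    and transl: "translative H \<Sigma> \<phi>"
    using assms(6) unfolding decoupled_def by (elim conjE exE) blast
  interpret H: comm_group H
    by (rule assms(1))
  interpret decoupled_complex H V \<Sigma> \<phi> Hs
  proof
    show "Hs i \<noteq> {\<one>\<^bsub>H\<^esub>}" if "i \<in> {0..complex_dim \<Sigma>}" for i
      using Hs(2) that by (rule bspec)
    show "\<exists>x. M = x ` {0..complex_dim \<Sigma>} \<and>
       (\<forall>i\<in>{0..complex_dim \<Sigma>}. Hs i = stabilizer H (face_action \<Sigma> \<phi>) (M - {x i}))"
      if "M \<in> maximal_faces \<Sigma>" for M
      using Hs(3) that by (rule bspec)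
  qed (fact assms Hs(1) transl)+
  show ?thesis
    using assms(7) by (rule homotopy_Cohen_Macaulay_face_orbits)
qed

end
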